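(* Consider the integrator reach set $\mathcal{R}(\{\bm{x}_0\},t)\subset\mathbb{R}^d$ (defined in the context) with singleton initial set $\{\bm{x}_0\}$ and input set $\mathcal{U}=[\alpha_1,\beta_1]\times\dots\times[\alpha_m,\beta_m]\subset\mathbb{R}^m$. The fixed vector $\bm{x}_0\in\mathbb{R}^d$ comprises subvectors $\bm{x}_{j0}\in\mathbb{R}^{r_j}$, $j=1,\dots,m$, where $\bm{r}=(r_1,\dots,r_m)^{\top}\in\mathbb{N}^m$ is the relative degree vector, $r_1+\dots+r_m=d$. Let $\mu_j=\frac{\beta_j-\alpha_j}{2}$ and $\nu_j=\frac{\beta_j+\alpha_j}{2}$ for $j=1,\dots,m$, and let $\mathbf{1}_{k\le\ell}:=1$ for $k\le\ell$ and $:=0$ otherwise. Then the components of $$\bm{x}^{\mathrm{bdy}}=\begin{pmatrix}\bm{x}^{\mathrm{bdy}}_1\\ \bm{x}^{\mathrm{bdy}}_2\\ \vdots\\ \bm{x}^{\mathrm{bdy}}_m\end{pmatrix}\in\partial\mathcal{R}(\{\bm{x}_0\},t),\qquad \bm{x}^{\mathrm{bdy}}_j\in\mathbb{R}^{r_j},\quad j=1,\dots,m,$$ admit the parameterization $$\bm{x}^{\mathrm{bdy}}_j(k)=\sum_{\ell=1}^{r_j}\mathbf{1}_{k\le\ell}\,\frac{t^{\ell-k}}{(\ell-k)!}\,\bm{x}_{j0}(\ell)+\frac{\nu_j\,t^{r_j-k+1}}{(r_j-k+1)!}\pm\frac{\mu_j}{(r_j-k+1)!}\left\{(-1)^{r_j-1}t^{r_j-k+1}+2\sum_{q=1}^{r_j-1}(-1)^{q+1}s_q^{\,r_j-k+1}\right\},$$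 where $\bm{x}^{\mathrm{bdy}}_j(k)$ denotes the $k$-th component of the $j$-th subvector $\bm{x}^{\mathrm{bdy}}_j$, $k=1,\dots,r_j$. The parameters $(s_1,s_2,\dots,s_{r_j-1})$ satisfy $0\le s_1\le s_2\le\dots\le s_{r_j-1}\le t$.
   Context: The integrator dynamics in Brunovsky normal form with $d$ states and $m$ inputs is $\dot{\bm{x}}=\bm{A}\bm{x}+\bm{B}\bm{u}$ with $\bm{A}=\mathrm{blkdiag}(\bm{A}_1,\dots,\bm{A}_m)$ and $\bm{B}=\mathrm{blkdiag}(\bm{b}_1,\dots,\bm{b}_m)$ (block diagonal matrices). Here $\bm{A}_j$ is the $r_j\times r_j$ matrix with ones on the superdiagonal and zeros elsewhere, and $\bm{b}_j\in\mathbb{R}^{r_j}$ is the last standard basis vector. The forward reach set $\mathcal{R}(\{\bm{x}_0\},t)\subset\mathbb{R}^d$ is the set of states that the controlled dynamics may reach at time $t$ starting from $\bm{x}_0$ with inputs taking values in $\mathcal{U}$. Equivalently, it is $\exp(t\bm{A})\bm{x}_0$ plus (Minkowski sum) the set-valued Aumann integral $\int_0^t\exp(s\bm{A})\bm{B}\,\mathcal{U}\,\mathrm{d}s$. It is compact and convex, and $\partial\mathcal{R}$ denotes its boundary. For a vector $\bm{v}$, $\bm{v}(k)$ is its $k$-th component. In the parameterization, the choice of plus sign for $\pm$ gives one parametric representation of $\bm{x}^{\mathrm{bdy}}_j$, and the choice of minus sign gives another.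
   Formalization: For m ≥ 2 a boundary point of R need not have every subvector of the displayed form (e.g. (1,0) in [-1,1]²); proved instead: each block's own boundary is exactly the parameterized set, and ∂R is the points of R with at least one such subvector. *)

theory Defs
  imports "HOL-Analysis.Analysis"
begin

text \<open>
  Stacked vectors: an input is indexed by the finite type \<open>'m\<close> (so \<open>m = CARD('m)\<close>), and a
  labelling \<open>e\<close> sends the \<open>k\<close>-th component of the \<open>j\<close>-th block, \<open>1 \<le> k \<le> r j\<close>, to a coordinate
  of the stacked vector.  The labelling is meant to be a bijection from \<open>block_index r\<close> onto the
  whole index type; stacking the blocks in order is one such labelling.
\<close>

definition block_index :: "('m \<Rightarrow> nat) \<Rightarrow> ('m \<times> nat) set" where
  "block_index r = (SIGMA j:UNIV. {1..r j})"

text \<open>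
  Subvectors have a length depending on \<open>j\<close>, so they are extensional functions on \<open>{1..r j}\<close>,
  i.e. points of the space \<open>powertop_real {1..r j}\<close>.
\<close>

definition subvec :: "('m \<Rightarrow> nat) \<Rightarrow> ('m \<times> nat \<Rightarrow> 'n) \<Rightarrow> 'm \<Rightarrow> real^'n \<Rightarrow> nat \<Rightarrow> real" where
  "subvec r e j x = (\<lambda>k\<in>{1..r j}. x $ e (j, k))"

text \<open>
  Rows are labelled by \<open>e\<close> on \<open>block_index r\<close>, columns by \<open>f\<close> on \<open>block_index c\<close>; the \<open>j\<close>-th
  diagonal block is the \<open>r j \<times> c j\<close> matrix \<open>M j\<close> (1-based indices).
\<close>

definition blkdiag ::
    "('m \<Rightarrow> nat) \<Rightarrow> ('m \<times> nat \<Rightarrow> 'n) \<Rightarrow> ('m \<Rightarrow> nat) \<Rightarrow> ('m \<times> nat \<Rightarrow> 'p)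
      \<Rightarrow> ('m \<Rightarrow> nat \<Rightarrow> nat \<Rightarrow> real) \<Rightarrow> real^'p^'n" where
  "blkdiag r e c f M =
    (\<chi> p q. case inv_into (block_index r) e p of (i, k) \<Rightarrow>
             case inv_into (block_index c) f q of (j, l) \<Rightarrow>
               if i = j then M j k l else 0)"

definition integrator_A ::
    "('m \<Rightarrow> nat) \<Rightarrow> ('m \<times> nat \<Rightarrow> 'n) \<Rightarrow> real^'n^'n" where
  "integrator_A r e = blkdiag r e r e (\<lambda>j k l. if l = k + 1 then 1 else 0)"

definition integrator_B ::
    "('m \<Rightarrow> nat) \<Rightarrow> ('m \<times> nat \<Rightarrow> 'n) \<Rightarrow> real^'m^'n" where
  "integrator_B r e = blkdiag r e (\<lambda>_. 1) fst (\<lambda>j k l. if k = r j then 1 else 0)"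

text \<open>
  States reachable at time \<open>t\<close> with measurable inputs, trajectories being Caratheodory solutions
  of \<open>x' = A x + B u\<close> (the integral form of the differential equation).
\<close>

definition reach_set ::
    "real^'n^'n \<Rightarrow> real^'m^'n \<Rightarrow> (real^'n) set \<Rightarrow> (real^'m) set \<Rightarrow> real \<Rightarrow> (real^'n) set" where
  "reach_set A B X0 U t =
    {x t | x u.
       x 0 \<in> X0 \<and>
       u \<in> borel_measurable (lebesgue_on {0..t}) \<and> (\<forall>s\<in>{0..t}. u s \<in> U) \<and>
       continuous_on {0..t} x \<and>
       (\<forall>\<tau>\<in>{0..t}. ((\<lambda>s. A *v x s + B *v u s) has_integral (x \<tau> - x 0)) {0..\<tau>})}"

text \<open>
  The \<open>k\<close>-th component of the parametric representation for a block of length \<open>n\<close> with initial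
  subvector \<open>z\<close>; \<open>\<sigma>\<close> is the sign \<open>\<plusminus>\<close> and \<open>s\<close> are the parameters \<open>s 1, \<dots>, s (n - 1)\<close>.
\<close>

definition bdy_comp ::
    "nat \<Rightarrow> (nat \<Rightarrow> real) \<Rightarrow> real \<Rightarrow> real \<Rightarrow> real \<Rightarrow> real \<Rightarrow> (nat \<Rightarrow> real) \<Rightarrow> nat \<Rightarrow> real" where
  "bdy_comp n z \<mu> \<nu> t \<sigma> s k =
    (\<Sum>l = 1..n. (if k \<le> l then 1 else 0) * (t ^ (l - k) / fact (l - k)) * z l)
    + \<nu> * t ^ (n - k + 1) / fact (n - k + 1)
    + \<sigma> * (\<mu> / fact (n - k + 1))
        * ((-1) ^ (n - 1) * t ^ (n - k + 1)
           + 2 * (\<Sum>q = 1..n - 1. (-1) ^ (q + 1) * s q ^ (n - k + 1)))"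

definition bdy_param ::
    "nat \<Rightarrow> (nat \<Rightarrow> real) \<Rightarrow> real \<Rightarrow> real \<Rightarrow> real \<Rightarrow> (nat \<Rightarrow> real) set" where
  "bdy_param n z \<mu> \<nu> t =
    {\<lambda>k\<in>{1..n}. bdy_comp n z \<mu> \<nu> t \<sigma> s k | \<sigma> s.
       \<sigma> \<in> {1, -1} \<and> mono_on {1..n - 1} s \<and> s ` {1..n - 1} \<subseteq> {0..t}}"

end

theory Submission
  imports Defs
begin

text \<open>
  Solving the integrator chain, a state of one block is \<open>x k = free part + \<integral> (t - s) ^ (n - k) / (n - k)! * u s\<close>, so a linear
  functional on the reach set of that block is integration of the input against a polynomial \<open>p\<close> of
  degree below \<open>n\<close> in \<open>t - s\<close>. It is maximized exactly by \<open>u = \<nu> + \<mu> * sgn p\<close>, an input with at most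
  \<open>n - 1\<close> switches; unused switches are placed at \<open>0\<close>. Conversely the polynomial with prescribed roots
  \<open>s\<^sub>q\<close> exposes the point with switches \<open>s\<^sub>q\<close>. Since \<open>p\<close> vanishes only on a finite set, almost maximal
  inputs are \<open>L\<^sup>1\<close>-close to the maximizer, hence every frontier point is attained; this gives
  closedness of the reach set without weak compactness. The reach set is the intersection of one cylinder
  per block, and a point of a finite intersection of closed sets lies on its frontier iff it lies on the frontier of
  one of them.
\<close>

section \<open>Sign patterns of polynomials\<close>

lemma poly_no_root_same_sign:
  fixes p :: "real poly"
  assumes "\<And>x. 0 < x \<Longrightarrow> x < t \<Longrightarrow> poly p x \<noteq> 0" and "0 \<le> t"
  obtains \<sigma> where "\<sigma> \<in> {1, -1::real}" "\<And>x. x \<in> {0..t} \<Longrightarrow> 0 \<le> \<sigma> * poly p x"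
proof -
  have "\<not> (x \<in> {0..t} \<and> y \<in> {0..t} \<and> x < y \<and> poly p x * poly p y < 0)" for x y
    using poly_IVT[of x y p] assms by fastforce
  then have "\<not> (poly p x < 0 \<and> 0 < poly p y)" if "x \<in> {0..t}" "y \<in> {0..t}" for x y
    using that by (metis linorder_neqE_linordered_idom mult.commute mult_neg_pos order_less_asym)
  then have "(\<forall>x\<in>{0..t}. 0 \<le> poly p x) \<or> (\<forall>x\<in>{0..t}. poly p x \<le> 0)"
    by (meson not_le)
  then show thesis
    using that[of 1] that[of "-1"] by auto
qed

text \<open>Each root of \<open>p\<close> in the open interval is split off and put into
  \<open>M\<close>, so the linear factor of \<open>p\<close> and the new factor of the product
  combine to a square up to sign. Once no such root is left, \<open>p\<close> keeps its sign on
  \<open>{0..t}\<close> and the remaining places of \<open>M\<close> are filled with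
  \<open>0\<close>. A multiset lets the roots be collected in any order and with
  multiplicity.\<close>

lemma poly_sign_pattern_mset:
  fixes p :: "real poly"
  assumes "p \<noteq> 0" "degree p \<le> N" "0 \<le> t"
  shows "\<exists>\<sigma>\<in>{1, -1}. \<exists>M. size M = N \<and> set_mset M \<subseteq> {0..t} \<and>
           (\<forall>x\<in>{0..t}. 0 \<le> \<sigma> * (\<Prod>a\<in>#M. a - x) * poly p x)"
  using assms(1,2)
proof (induction N arbitrary: p)
  case 0
  then obtain c where p: "p = [:c:]"
    by (metis degree_eq_zeroE le_zero_eq)
  then show ?case
    by (intro bexI[of _ "if 0 \<le> c then 1 else -1"] exI[of _ "{#}"]) auto
next
  case (Suc N)
  show ?case
  proof (cases "\<exists>a. 0 < a \<and> a < t \<and> poly p a = 0")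
    case True
    then obtain a where a: "0 < a" "a < t" "poly p a = 0" by blast
    then obtain p' where p': "p = [:-a, 1:] * p'"
      by (metis dvdE poly_eq_0_iff_dvd)
    with Suc.prems have "p' \<noteq> 0" by auto
    moreover have "degree p = Suc (degree p')"
      unfolding p' using \<open>p' \<noteq> 0\<close> by (subst degree_mult_eq) auto
    ultimately obtain \<sigma> M where M: "\<sigma> \<in> {1, -1}" "size M = N" "set_mset M \<subseteq> {0..t}"
        "\<forall>x\<in>{0..t}. 0 \<le> \<sigma> * (\<Prod>a\<in>#M. a - x) * poly p' x"
      using Suc.IH[of p'] Suc.prems by fastforce
    have "0 \<le> - \<sigma> * (\<Prod>b\<in>#add_mset a M. b - x) * poly p x" if "x \<in> {0..t}" for x
    proof -
      have "- \<sigma> * (\<Prod>b\<in>#add_mset a M. b - x) * poly p x =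
          (a - x)\<^sup>2 * (\<sigma> * (\<Prod>a\<in>#M. a - x) * poly p' x)"
        unfolding p' by (simp add: power2_eq_square algebra_simps)
      then show ?thesis using M(4) that by simp
    qed
    then show ?thesis
      using M a by (intro bexI[of _ "-\<sigma>"] exI[of _ "add_mset a M"]) auto
  next
    case False
    then obtain \<sigma> where \<sigma>: "\<sigma> \<in> {1, -1::real}" "\<And>x. x \<in> {0..t} \<Longrightarrow> 0 \<le> \<sigma> * poly p x"
      using poly_no_root_same_sign[of t p] assms(3) by auto
    \<comment> \<open>A padding root \<open>0\<close> contributes the factor \<open>0 - x\<close>,
      which never becomes positive on \<open>{0..t}\<close>. Padding thus only changes the global
      sign, and \<open>(-1) ^ Suc N\<close> corrects that.\<close>
    have "0 \<le> (\<sigma> * (-1) ^ Suc N) * (\<Prod>b\<in>#replicate_mset (Suc N) 0. b - x) * poly p x"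
      if "x \<in> {0..t}" for x
    proof -
      have "(\<Prod>b\<in>#replicate_mset (Suc N) 0. b - x) = (-1) ^ Suc N * x ^ Suc N"
        by (subst power_mult_distrib[symmetric]) simp
      then have "(\<sigma> * (-1) ^ Suc N) * (\<Prod>b\<in>#replicate_mset (Suc N) 0. b - x) * poly p x =
          ((-1) ^ Suc N * (-1) ^ Suc N) * x ^ Suc N * (\<sigma> * poly p x)"
        by (simp only: mult_ac)
      also have "\<dots> = x ^ Suc N * (\<sigma> * poly p x)"
        by (simp flip: power_mult_distrib)
      finally show ?thesis
        using mult_nonneg_nonneg[OF zero_le_power[of x "Suc N"] \<sigma>(2)[OF that]] that
        by (metis atLeastAtMost_iff)
    qed
    then show ?thesis
      using \<sigma>(1) assms(3)
      by (intro bexI[of _ "\<sigma> * (-1) ^ Suc N"] exI[of _ "replicate_mset (Suc N) 0"])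
        (auto simp: minus_one_power_iff)
  qed
qed

text \<open>The product is independent of the order of the roots, so the multiset may be sorted.
  This yields the ordered parameters that \<open>bdy_param\<close> asks for; \<open>s\<close> is
  1-based whereas list positions start at 0.\<close>

lemma poly_sign_pattern:
  fixes p :: "real poly"
  assumes "p \<noteq> 0" "degree p \<le> N" "0 \<le> t"
  obtains \<sigma> s where "\<sigma> \<in> {1, -1}" "mono_on {1..N} s" "s ` {1..N} \<subseteq> {0..t}"
    "\<And>x. x \<in> {0..t} \<Longrightarrow> 0 \<le> \<sigma> * (\<Prod>q=1..N. s q - x) * poly p x"
proof -
  from poly_sign_pattern_mset[OF assms] obtain \<sigma> M
    where M: "\<sigma> \<in> {1, -1}" "size M = N" "set_mset M \<subseteq> {0..t}"
      "\<forall>x\<in>{0..t}. 0 \<le> \<sigma> * (\<Prod>a\<in>#M. a - x) * poly p x" by blast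
  define xs where "xs = sorted_list_of_multiset M"
  have xs: "sorted xs" "mset xs = M" "length xs = N"
    unfolding xs_def using M(2) by (auto simp flip: size_mset)
  define s where "s q = xs ! (q - 1)" for q
  have "(\<Prod>q=1..N. s q - x) = (\<Prod>a\<in>#M. a - x)" for x
  proof -
    have "(\<Prod>q=1..N. s q - x) = (\<Prod>i<N. xs ! i - x)"
      unfolding s_def by (rule prod.reindex_bij_witness[of _ Suc "\<lambda>q. q - 1"]) auto
    also have "\<dots> = prod_list (map (\<lambda>a. a - x) xs)"
      by (simp add: prod.list_conv_set_nth xs(3) lessThan_atLeast0)
    also have "\<dots> = (\<Prod>a\<in>#M. a - x)"
      by (metis mset_map prod_mset_prod_list xs(2))
    finally show ?thesis .
  qed
  moreover have "mono_on {1..N} s"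
    unfolding s_def using xs by (intro mono_onI sorted_nth_mono) auto
  moreover have "s ` {1..N} \<subseteq> {0..t}"
  proof -
    have "xs ! i \<in> {0..t}" if "i < N" for i
      using M(3) xs(2,3) that by (metis nth_mem_mset subsetD)
    then show ?thesis unfolding s_def by fastforce
  qed
  ultimately show thesis using that M by metis
qed

section \<open>Integrals of monomials against sign patterns\<close>

lemma has_derivative_power_fact:
  "((\<lambda>x::real. x ^ Suc k / fact (Suc k)) has_real_derivative x ^ k / fact k) (at x within S)"
proof -
  have "((\<lambda>x. x ^ Suc k / fact (Suc k)) has_real_derivative (Suc k * x ^ k) / fact (Suc k)) (at x within S)"
    using DERIV_pow[of "Suc k" x S] by (intro DERIV_cdivide) simp
  moreover have "(Suc k * x ^ k) / fact (Suc k) = x ^ k / fact k"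
    unfolding fact_Suc of_nat_mult by (rule mult_divide_mult_cancel_left) simp
  ultimately show ?thesis by (simp only:)
qed

lemma has_integral_power_fact:
  fixes a b :: real
  assumes "a \<le> b"
  shows "((\<lambda>x. x ^ k / fact k) has_integral
           (b ^ Suc k / fact (Suc k) - a ^ Suc k / fact (Suc k))) {a..b}"
  using assms has_derivative_power_fact
  by (intro fundamental_theorem_of_calculus)
    (auto simp flip: has_real_derivative_iff_has_vector_derivative simp del: fact_Suc power_Suc)

lemma sgn_prod_real: "sgn (\<Prod>x\<in>A. f x) = (\<Prod>x\<in>A. sgn (f x :: real))"
  by (induction A rule: infinite_finite_induct) (auto simp: sgn_mult)

text \<open>Splitting the interval at the last switching time reduces \<open>Suc N\<close> switches on \<open>{0..t}\<close> to
  \<open>N\<close> switches on \<open>{0..s (Suc N)}\<close>.\<close>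

lemma has_integral_sgn_prod:
  fixes s :: "nat \<Rightarrow> real"
  assumes "0 \<le> t" "mono_on {1..N} s" "s ` {1..N} \<subseteq> {0..t}"
  shows "((\<lambda>x. x ^ k / fact k * sgn (\<Prod>q=1..N. s q - x)) has_integral
     ((-1) ^ N * t ^ Suc k + 2 * (\<Sum>q=1..N. (-1) ^ (q + 1) * s q ^ Suc k)) / fact (Suc k)) {0..t}"
  using assms
proof (induction N arbitrary: t)
  case 0
  have "((\<lambda>x::real. x ^ k / fact k) has_integral (t ^ Suc k / fact (Suc k) - 0 ^ Suc k / fact (Suc k))) {0..t}"
    using 0 by (intro has_integral_power_fact) auto
  then show ?case by simp
next
  case (Suc N)
  define c where "c = s (Suc N)"
  have c: "0 \<le> c" "c \<le> t"
    using subsetD[OF Suc.prems(3), of "s (Suc N)"] unfolding c_def by auto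
  have le: "s q \<le> c" if "q \<in> {1..N}" for q
    using mono_onD[OF Suc.prems(2), of q "Suc N"] that unfolding c_def by auto
  have "((\<lambda>x. x ^ k / fact k * sgn (\<Prod>q=1..N. s q - x)) has_integral
     ((-1) ^ N * c ^ Suc k + 2 * (\<Sum>q=1..N. (-1) ^ (q + 1) * s q ^ Suc k)) / fact (Suc k)) {0..c}"
  proof (rule Suc.IH)
    show "s ` {1..N} \<subseteq> {0..c}"
    proof
      fix x assume "x \<in> s ` {1..N}"
      then obtain q where "x = s q" "q \<in> {1..N}" by blast
      then show "x \<in> {0..c}" using le subsetD[OF Suc.prems(3), of "s q"] by auto
    qed
  qed (use Suc.prems c in \<open>auto intro: mono_on_subset\<close>)
  \<comment> \<open>To the left of \<open>c\<close> the additional factor \<open>c - x\<close> is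
    positive, so the sign changes at most at \<open>c\<close> itself.\<close>
  then have 1: "((\<lambda>x. x ^ k / fact k * sgn (\<Prod>q=1..Suc N. s q - x)) has_integral
     ((-1) ^ N * c ^ Suc k + 2 * (\<Sum>q=1..N. (-1) ^ (q + 1) * s q ^ Suc k)) / fact (Suc k)) {0..c}"
    by (rule has_integral_spike_finite[of "{c}", rotated 2])
      (auto simp: sgn_mult c_def[symmetric])
  have "((\<lambda>x::real. x ^ k / fact k) has_integral
      (t ^ Suc k / fact (Suc k) - c ^ Suc k / fact (Suc k))) {c..t}"
    using c by (intro has_integral_power_fact) auto
  then have "((\<lambda>x::real. x ^ k / fact k * (-1) ^ Suc N) has_integral
      (t ^ Suc k / fact (Suc k) - c ^ Suc k / fact (Suc k)) * (-1) ^ Suc N) {c..t}"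
    by (rule has_integral_mult_left)
  then have 2: "((\<lambda>x. x ^ k / fact k * sgn (\<Prod>q=1..Suc N. s q - x)) has_integral
      (t ^ Suc k / fact (Suc k) - c ^ Suc k / fact (Suc k)) * (-1) ^ Suc N) {c..t}"
  proof (rule has_integral_spike_finite[of "{c}", rotated 2])
    fix x assume x: "x \<in> {c..t} - {c}"
    have "sgn (\<Prod>q=1..Suc N. s q - x) = (\<Prod>q=1..Suc N. sgn (s q - x))"
      by (rule sgn_prod_real)
    also have "\<dots> = (\<Prod>q=1..Suc N. -1)"
    proof (intro prod.cong refl)
      fix q assume "q \<in> {1..Suc N}"
      then have "s q \<le> c" using le[of q] by (cases "q = Suc N") (auto simp: c_def)
      then show "sgn (s q - x) = -1" using x by simp
    qed
    finally show "x ^ k / fact k * sgn (\<Prod>q=1..Suc N. s q - x) = x ^ k / fact k * (-1) ^ Suc N"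
      by simp
  qed auto
  \<comment> \<open>Both pieces contribute \<open>(-1) ^ N * c ^ Suc k\<close> to the numerator.
    Together these are the summand for \<open>q = Suc N\<close>, which explains the factor
    2.\<close>
  have "((-1) ^ N * c ^ Suc k + 2 * (\<Sum>q=1..N. (-1) ^ (q + 1) * s q ^ Suc k)) / fact (Suc k) +
      (t ^ Suc k / fact (Suc k) - c ^ Suc k / fact (Suc k)) * (-1) ^ Suc N =
     ((-1) ^ Suc N * t ^ Suc k + 2 * (\<Sum>q=1..Suc N. (-1) ^ (q + 1) * s q ^ Suc k)) / fact (Suc k)"
    by (simp add: c_def[symmetric] add_divide_distrib diff_divide_distrib ring_distribs mult_ac)
  then show ?case
    using has_integral_combine[OF c 1 2] by simp
qed

section \<open>Repeated integration\<close>

lemma integrable_continuous_times_bounded: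
  fixes g u :: "real \<Rightarrow> real"
  assumes "u \<in> borel_measurable (lebesgue_on {a..b})" "\<And>s. s \<in> {a..b} \<Longrightarrow> \<bar>u s\<bar> \<le> M"
    and "continuous_on {a..b} g"
  shows "(\<lambda>s. g s * u s) integrable_on {a..b}"
proof -
  have "bounded (u ` {a..b})"
    unfolding bounded_iff using assms(2) by (intro exI[of _ M]) auto
  then have "(\<lambda>s. u s * g s) absolutely_integrable_on {a..b}"
    using assms by (intro absolutely_integrable_bounded_measurable_product_real)
      (auto intro: absolutely_integrable_continuous_real)
  then show ?thesis
    by (simp add: mult.commute set_lebesgue_integral_eq_integral(1))
qed

text \<open>The difference quotients at \<open>x\<close> are bounded by
  \<open>K * \<bar>y - x\<bar>\<close>, so the derivative is zero throughout the interval.\<close>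

lemma quadratic_increment_imp_constant:
  fixes D :: "real \<Rightarrow> real"
  assumes "\<And>a b. a \<in> {0..t} \<Longrightarrow> b \<in> {0..t} \<Longrightarrow> a \<le> b \<Longrightarrow> \<bar>D b - D a\<bar> \<le> K * (b - a)\<^sup>2"
    and "x \<in> {0..t}" "y \<in> {0..t}"
  shows "D x = D y"
proof -
  have sym: "\<bar>D b - D a\<bar> \<le> K * (b - a)\<^sup>2" if "a \<in> {0..t}" "b \<in> {0..t}" for a b
    using assms(1)[of a b] assms(1)[of b a] that
    by (cases "a \<le> b") (auto simp: abs_minus_commute power2_commute)
  have "(D has_field_derivative 0) (at x within {0..t})" if x: "x \<in> {0..t}" for x
  proof -
    have "((\<lambda>y. (D y - D x) / (y - x)) \<longlongrightarrow> 0) (at x within {0..t})"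
    proof (rule Lim_null_comparison)
      show "\<forall>\<^sub>F y in at x within {0..t}. norm ((D y - D x) / (y - x)) \<le> K * \<bar>y - x\<bar>"
        unfolding eventually_at_topological
      proof (intro exI[of _ UNIV] conjI ballI impI)
        fix y assume "y \<noteq> x" "y \<in> {0..t}"
        then show "norm ((D y - D x) / (y - x)) \<le> K * \<bar>y - x\<bar>"
          using sym[OF x, of y] by (simp add: divide_le_eq power2_eq_square mult.assoc flip: abs_mult)
      qed auto
      have "((\<lambda>y. K * \<bar>y - x\<bar>) \<longlongrightarrow> K * \<bar>x - x\<bar>) (at x within {0..t})"
        by (intro tendsto_intros)
      then show "((\<lambda>y. K * \<bar>y - x\<bar>) \<longlongrightarrow> 0) (at x within {0..t})" by simp
    qed
    then show ?thesis by (simp add: has_field_derivative_iff)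
  qed
  then have "\<exists>c. \<forall>x\<in>{0..t}. D x = c"
    by (intro has_field_derivative_zero_constant) auto
  then show ?thesis using assms(2,3) by auto
qed

text \<open>As \<open>y\<close> need not be differentiable anywhere, the integration by parts formula is obtained from
  the fact that its defect has quadratically small increments.\<close>

lemma has_integral_by_parts_bounded:
  fixes g g' h y :: "real \<Rightarrow> real"
  assumes t: "0 \<le> t"
    and h: "h \<in> borel_measurable (lebesgue_on {0..t})" "\<And>s. s \<in> {0..t} \<Longrightarrow> \<bar>h s\<bar> \<le> M"
    and y: "\<And>\<tau>. \<tau> \<in> {0..t} \<Longrightarrow> (h has_integral (y \<tau> - y 0)) {0..\<tau>}"
    and g: "\<And>s. s \<in> {0..t} \<Longrightarrow> (g has_real_derivative g' s) (at s within {0..t})"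
    and g': "continuous_on {0..t} g'"
  shows "((\<lambda>s. g s * h s) has_integral
           (g t * y t - g 0 * y 0 - integral {0..t} (\<lambda>s. g' s * y s))) {0..t}"
proof -
  have g_cont: "continuous_on {0..t} g"
    using g by (intro DERIV_continuous_on) auto
  have h_int: "(h has_integral (y b - y a)) {a..b}" if "0 \<le> a" "a \<le> b" "b \<le> t" for a b
  proof -
    have "h integrable_on {a..b}"
      using y[of b] that by (intro integrable_on_subinterval[OF has_integral_integrable]) auto
    moreover have "integral {0..a} h + integral {a..b} h = integral {0..b} h"
      using y[of b] that by (intro Henstock_Kurzweil_Integration.integral_combine) auto
    ultimately show ?thesis
      using y[of a] y[of b] that by (simp add: has_integral_iff)
  qed
  have g'_int: "(g' has_integral (g b - g a)) {a..b}" if "0 \<le> a" "a \<le> b" "b \<le> t" for a b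
  proof (rule fundamental_theorem_of_calculus)
    fix s assume "s \<in> {a..b}"
    then show "(g has_vector_derivative g' s) (at s within {a..b})"
      using that unfolding has_real_derivative_iff_has_vector_derivative[symmetric]
      by (intro DERIV_subset[OF g]) auto
  qed (use that in auto)
  obtain L where L: "\<And>s. s \<in> {0..t} \<Longrightarrow> \<bar>g' s\<bar> \<le> L"
    using compact_imp_bounded[OF compact_continuous_image[OF g']]
    unfolding bounded_iff by (metis compact_Icc image_eqI real_norm_def)
  have M0: "0 \<le> M" and L0: "0 \<le> L"
    using h(2)[of 0] L[of 0] t by auto
  have y_lip: "\<bar>y b - y a\<bar> \<le> M * (b - a)" if "0 \<le> a" "a \<le> b" "b \<le> t" for a b
    using has_integral_bound_real[OF M0 _ h_int[OF that]] h(2) that by auto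
  have g_lip: "\<bar>g b - g a\<bar> \<le> L * (b - a)" if "0 \<le> a" "a \<le> b" "b \<le> t" for a b
    using has_integral_bound_real[OF L0 _ g'_int[OF that]] L that by auto
  have y_cont: "continuous_on {0..t} y"
  proof -
    have "continuous_on {0..t} (\<lambda>\<tau>. y 0 + integral {0..\<tau>} h)"
      using y[of t] t by (intro continuous_intros indefinite_integral_continuous_1) auto
    then show ?thesis
      using y by (elim continuous_on_eq) (fastforce simp: has_integral_iff)
  qed
  have gy: "(\<lambda>s. g' s * y s) integrable_on {a..b}" if "0 \<le> a" "b \<le> t" for a b
    using that g' y_cont
    by (intro integrable_continuous_real continuous_intros) (auto intro: continuous_on_subset)
  have gh: "(\<lambda>s. g s * h s) integrable_on {a..b}" if "0 \<le> a" "b \<le> t" for a b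
    using that integrable_on_subinterval[OF integrable_continuous_times_bounded[OF h g_cont]] by auto
  \<comment> \<open>\<open>D\<close> is the defect of integration by parts on
    \<open>{0..\<tau>}\<close>; the claim amounts to \<open>D t = D 0\<close>.\<close>
  define D where "D \<tau> = g \<tau> * y \<tau> - integral {0..\<tau>} (\<lambda>s. g' s * y s) - integral {0..\<tau>} (\<lambda>s. g s * h s)" for \<tau>
  have "\<bar>D b - D a\<bar> \<le> (2 * L * M) * (b - a)\<^sup>2" if ab: "a \<in> {0..t}" "b \<in> {0..t}" "a \<le> b" for a b
  proof -
    \<comment> \<open>Freezing \<open>y\<close> at \<open>b\<close> and \<open>g\<close> at
      \<open>a\<close> gives an integrand whose integral is exactly the increment of
      \<open>g * y\<close>. Its difference from the true integrand contains an increment of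
      \<open>y\<close> or of \<open>g\<close> in each term, hence is of order \<open>b - a\<close>
      by the Lipschitz bounds; integration supplies the second factor \<open>b - a\<close>.\<close>
    have "((\<lambda>s. g' s * y b + g a * h s) has_integral ((g b - g a) * y b + g a * (y b - y a))) {a..b}"
      using ab by (intro has_integral_add has_integral_mult_left has_integral_mult_right g'_int h_int) auto
    moreover have "((\<lambda>s. g' s * y s + g s * h s) has_integral
        (integral {a..b} (\<lambda>s. g' s * y s) + integral {a..b} (\<lambda>s. g s * h s))) {a..b}"
      using ab by (intro has_integral_add integrable_integral gy gh) auto
    ultimately have "((\<lambda>s. (g' s * y b + g a * h s) - (g' s * y s + g s * h s)) has_integral
        ((g b - g a) * y b + g a * (y b - y a)
          - (integral {a..b} (\<lambda>s. g' s * y s) + integral {a..b} (\<lambda>s. g s * h s)))) {a..b}"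
      by (rule has_integral_diff)
    moreover have "integral {0..a} (\<lambda>s. g' s * y s) + integral {a..b} (\<lambda>s. g' s * y s)
        = integral {0..b} (\<lambda>s. g' s * y s)"
      using ab by (intro Henstock_Kurzweil_Integration.integral_combine gy) auto
    moreover have "integral {0..a} (\<lambda>s. g s * h s) + integral {a..b} (\<lambda>s. g s * h s)
        = integral {0..b} (\<lambda>s. g s * h s)"
      using ab by (intro Henstock_Kurzweil_Integration.integral_combine gh) auto
    moreover have "(g b - g a) * y b + g a * (y b - y a) = g b * y b - g a * y a"
      by (simp add: algebra_simps)
    ultimately have "((\<lambda>s. (g' s * y b + g a * h s) - (g' s * y s + g s * h s)) has_integral
        (D b - D a)) {a..b}"
      by (elim has_integral_eq_rhs) (simp add: D_def)
    moreover have "(g' s * y b + g a * h s) - (g' s * y s + g s * h s) =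
        g' s * (y b - y s) + (g a - g s) * h s" for s
      by (simp add: algebra_simps)
    ultimately have "((\<lambda>s. g' s * (y b - y s) + (g a - g s) * h s) has_integral (D b - D a)) {a..b}"
      by (simp only:)
    moreover have "\<bar>g' s * (y b - y s) + (g a - g s) * h s\<bar> \<le> 2 * L * M * (b - a)"
      if s: "s \<in> {a..b}" for s
    proof -
      have "\<bar>g' s * (y b - y s)\<bar> \<le> L * (M * (b - a))"
        unfolding abs_mult using y_lip[of s b] L[of s] s ab L0 M0
        by (intro mult_mono order_trans[OF y_lip[of s b]] mult_left_mono) auto
      moreover have "\<bar>(g a - g s) * h s\<bar> \<le> (L * (b - a)) * M"
        unfolding abs_mult using h(2)[of s] s ab L0 M0 abs_minus_commute[of "g a" "g s"]
        by (intro mult_mono order_trans[OF _ order_trans[OF g_lip[of a s] mult_left_mono]]) auto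
      ultimately show ?thesis
        by (auto simp: algebra_simps intro: order_trans[OF abs_triangle_ineq])
    qed
    moreover have "0 \<le> 2 * L * M * (b - a)"
      using ab L0 M0 by simp
    ultimately have "\<bar>D b - D a\<bar> \<le> 2 * L * M * (b - a) * (b - a)"
      using has_integral_bound_real[of "2 * L * M * (b - a)" "{}" _ "D b - D a" a b] ab by auto
    then show ?thesis by (simp add: power2_eq_square algebra_simps)
  qed
  then have "D t = D 0"
    by (rule quadratic_increment_imp_constant) (use t in auto)
  then show ?thesis
    using gh[of 0 t] by (simp add: D_def has_integral_iff algebra_simps)
qed

text \<open>Taylor's formula with integral remainder for a chain whose last level
  \<open>y (Suc n)\<close> is the input. Each integration by parts climbs one level; the kernel
  \<open>(t - s) ^ Suc d / fact (Suc d)\<close> vanishes at \<open>s = t\<close>, so only initial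
  values survive as boundary terms.\<close>

lemma iterated_integral_taylor:
  fixes y :: "nat \<Rightarrow> real \<Rightarrow> real"
  assumes t: "0 \<le> t" and k: "1 \<le> k" "k \<le> n"
    and int: "\<And>i \<tau>. i \<in> {1..n} \<Longrightarrow> \<tau> \<in> {0..t} \<Longrightarrow> (y (Suc i) has_integral (y i \<tau> - y i 0)) {0..\<tau>}"
    and cont: "\<And>i. i \<in> {1..n} \<Longrightarrow> continuous_on {0..t} (y i)"
    and input: "y (Suc n) \<in> borel_measurable (lebesgue_on {0..t})" "\<And>s. s \<in> {0..t} \<Longrightarrow> \<bar>y (Suc n) s\<bar> \<le> M"
  shows "y k t = (\<Sum>l=1..n. (if k \<le> l then 1 else 0) * (t ^ (l - k) / fact (l - k)) * y l 0)
           + integral {0..t} (\<lambda>s. (t - s) ^ (n - k) / fact (n - k) * y (Suc n) s)"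
proof -
  have bounded: "\<exists>M. \<forall>s\<in>{0..t}. \<bar>y (Suc i) s\<bar> \<le> M"
    and measurable: "y (Suc i) \<in> borel_measurable (lebesgue_on {0..t})" if "i \<in> {1..n}" for i
  proof -
    have "i = n \<or> Suc i \<in> {1..n}" using that by auto
    then show "y (Suc i) \<in> borel_measurable (lebesgue_on {0..t})"
      using cont input(1) continuous_imp_measurable_on_sets_lebesgue[of "{0..t}" "y (Suc i)"] by auto
    show "\<exists>M. \<forall>s\<in>{0..t}. \<bar>y (Suc i) s\<bar> \<le> M"
      using \<open>i = n \<or> _\<close>
    proof
      assume "Suc i \<in> {1..n}"
      then show ?thesis
        using compact_imp_bounded[OF compact_continuous_image[OF cont]] by (auto simp: bounded_iff)
    next
      assume "i = n"
      then show ?thesis using input(2) by (intro exI[of _ M]) auto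
    qed
  qed
  \<comment> \<open>The remainder after \<open>d\<close> steps involves level
    \<open>Suc (k + d)\<close>. Every such level is bounded and measurable, so the last step, which
    reaches the input, needs no separate treatment.\<close>
  have "y k t = (\<Sum>l=k..k+d. t ^ (l - k) / fact (l - k) * y l 0)
      + integral {0..t} (\<lambda>s. (t - s) ^ d / fact d * y (Suc (k + d)) s)" if "k + d \<le> n" for d
    using that
  proof (induction d)
    case 0
    then show ?case
      using int[of k t] k t by (simp add: has_integral_iff)
  next
    case (Suc d)
    define p where "p = k + d"
    have "Suc p \<in> {1..n}" using Suc.prems k by (auto simp: p_def)
    from bounded[OF this] obtain M where M: "\<forall>s\<in>{0..t}. \<bar>y (Suc (Suc p)) s\<bar> \<le> M" ..
    have "((\<lambda>s. (t - s) ^ Suc d / fact (Suc d) * y (Suc (Suc p)) s) has_integral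
        ((t - t) ^ Suc d / fact (Suc d) * y (Suc p) t - (t - 0) ^ Suc d / fact (Suc d) * y (Suc p) 0
          - integral {0..t} (\<lambda>s. - ((t - s) ^ d / fact d) * y (Suc p) s))) {0..t}"
    proof (rule has_integral_by_parts_bounded[OF t _ M[rule_format]])
      show "y (Suc (Suc p)) \<in> borel_measurable (lebesgue_on {0..t})"
        using Suc.prems k by (intro measurable) (auto simp: p_def)
      show "(y (Suc (Suc p)) has_integral (y (Suc p) \<tau> - y (Suc p) 0)) {0..\<tau>}" if "\<tau> \<in> {0..t}" for \<tau>
        using Suc.prems k that by (intro int) (auto simp: p_def)
      show "((\<lambda>s. (t - s) ^ Suc d / fact (Suc d)) has_real_derivative - ((t - s) ^ d / fact d)) (at s within {0..t})" for s
      proof -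
        have "((\<lambda>s. t - s) has_real_derivative -1) (at s within {0..t})"
          by (auto intro!: derivative_eq_intros)
        from DERIV_chain'[OF this has_derivative_power_fact] show ?thesis
          by (simp only: mult_minus1_right)
      qed
    qed (auto intro!: continuous_intros)
    then have "integral {0..t} (\<lambda>s. (t - s) ^ Suc d / fact (Suc d) * y (Suc (Suc p)) s) =
        integral {0..t} (\<lambda>s. (t - s) ^ d / fact d * y (Suc p) s) - t ^ Suc d / fact (Suc d) * y (Suc p) 0"
      by (simp add: has_integral_iff)
    then show ?case
      using Suc.IH Suc.prems by (simp add: p_def)
  qed
  from this[of "n - k"] have "y k t = (\<Sum>l=k..n. t ^ (l - k) / fact (l - k) * y l 0)
      + integral {0..t} (\<lambda>s. (t - s) ^ (n - k) / fact (n - k) * y (Suc n) s)"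
    using k by simp
  also have "(\<Sum>l=k..n. t ^ (l - k) / fact (l - k) * y l 0) =
      (\<Sum>l=1..n. (if k \<le> l then 1 else 0) * (t ^ (l - k) / fact (l - k)) * y l 0)"
    using k by (intro sum.mono_neutral_cong_left) auto
  finally show ?thesis .
qed

lemma integrator_chain_exists:
  fixes u :: "real \<Rightarrow> real"
  assumes "u integrable_on {0..t}"
  obtains y where "y (Suc n) = u"
    "\<And>i. i \<in> {1..n} \<Longrightarrow> y i 0 = z i"
    "\<And>i. i \<in> {1..n} \<Longrightarrow> continuous_on {0..t} (y i)"
    "\<And>i \<tau>. i \<in> {1..n} \<Longrightarrow> \<tau> \<in> {0..t} \<Longrightarrow> (y (Suc i) has_integral (y i \<tau> - y i 0)) {0..\<tau>}"
proof -
  \<comment> \<open>The recursion starts at the input and integrates downwards, so level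
    \<open>k\<close> of the chain is \<open>Y (Suc n - k)\<close>. Accordingly
    \<open>Y (Suc i)\<close> is level \<open>n - i\<close> and receives the initial value
    \<open>z (n - i)\<close>.\<close>
  define Y where "Y = rec_nat u (\<lambda>i f \<tau>. z (n - i) + integral {0..\<tau>} f)"
  have Y0: "Y 0 = u" and Y_Suc: "Y (Suc i) = (\<lambda>\<tau>. z (n - i) + integral {0..\<tau>} (Y i))" for i
    by (simp_all add: Y_def)
  have int: "Y i integrable_on {0..t}" for i
    by (induction i) (auto simp: Y0 Y_Suc assms
        intro!: integrable_continuous_real continuous_intros indefinite_integral_continuous_1)
  have cont: "continuous_on {0..t} (Y (Suc i))" for i
    unfolding Y_Suc using int by (intro continuous_intros indefinite_integral_continuous_1)
  have eq: "Suc n - i = Suc (n - i)" "Suc n - Suc i = n - i" "n - (n - i) = i" if "i \<in> {1..n}" for i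
    using that by auto
  show thesis
  proof (rule that[of "\<lambda>k. Y (Suc n - k)"])
    fix i \<tau> assume i: "i \<in> {1..n}" and \<tau>: "\<tau> \<in> {0..t}"
    have "Y (n - i) integrable_on {0..\<tau>}"
      using \<tau> by (intro integrable_on_subinterval[OF int]) auto
    then show "(Y (Suc n - Suc i) has_integral (Y (Suc n - i) \<tau> - Y (Suc n - i) 0)) {0..\<tau>}"
      unfolding eq[OF i] Y_Suc by (simp add: has_integral_iff)
  next
    fix i assume i: "i \<in> {1..n}"
    show "continuous_on {0..t} (Y (Suc n - i))"
      unfolding eq(1)[OF i] by (rule cont)
    show "Y (Suc n - i) 0 = z i"
      unfolding eq(1)[OF i] Y_Suc using eq(3)[OF i] by simp
  qed (simp add: Y0)
qed

section \<open>Responses to admissible inputs\<close>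

definition admissible :: "real \<Rightarrow> real \<Rightarrow> real \<Rightarrow> (real \<Rightarrow> real) set" where
  "admissible a b t = {u. u \<in> borel_measurable (lebesgue_on {0..t}) \<and> (\<forall>s\<in>{0..t}. u s \<in> {a..b})}"

text \<open>This is the variation of constants formula for one block. The restriction to
  \<open>{1..n}\<close> makes the value a point of the space that contains the subvectors.\<close>

definition response :: "nat \<Rightarrow> (nat \<Rightarrow> real) \<Rightarrow> real \<Rightarrow> (real \<Rightarrow> real) \<Rightarrow> nat \<Rightarrow> real" where
  "response n z t u = (\<lambda>k\<in>{1..n}.
     (\<Sum>l=1..n. (if k \<le> l then 1 else 0) * (t ^ (l - k) / fact (l - k)) * z l)
     + integral {0..t} (\<lambda>s. (t - s) ^ (n - k) / fact (n - k) * u s))"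

text \<open>A bang-bang input with values \<open>\<nu> + \<mu>\<close> and
  \<open>\<nu> - \<mu>\<close>, and \<open>\<nu>\<close> at the switches because
  \<open>sgn 0 = 0\<close>. The parameters are measured in remaining time \<open>t - x\<close>, the
  variable in which the response kernels are monomials.\<close>

definition switching :: "real \<Rightarrow> real \<Rightarrow> real \<Rightarrow> real \<Rightarrow> nat \<Rightarrow> (nat \<Rightarrow> real) \<Rightarrow> real \<Rightarrow> real" where
  "switching \<mu> \<nu> t \<sigma> N s x = \<nu> + \<mu> * (\<sigma> * sgn (\<Prod>q=1..N. s q - (t - x)))"

lemma admissible_bound:
  assumes "u \<in> admissible a b t" "s \<in> {0..t}"
  shows "\<bar>u s\<bar> \<le> max \<bar>a\<bar> \<bar>b\<bar>"
proof -
  have "a \<le> u s \<and> u s \<le> b" using assms by (auto simp: admissible_def)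
  then show ?thesis by linarith
qed

lemma admissible_measurable:
  "u \<in> admissible a b t \<Longrightarrow> u \<in> borel_measurable (lebesgue_on {0..t})"
  by (simp add: admissible_def)

lemma admissible_integrable:
  assumes "u \<in> admissible a b t" "continuous_on {0..t} g"
  shows "(\<lambda>s. g s * u s) integrable_on {0..t}"
  using admissible_bound[OF assms(1)] admissible_measurable[OF assms(1)] assms(2)
  by (intro integrable_continuous_times_bounded)

lemma switching_admissible:
  assumes "0 \<le> \<mu>" "\<sigma> \<in> {1, -1}"
  shows "switching \<mu> \<nu> t \<sigma> N s \<in> admissible (\<nu> - \<mu>) (\<nu> + \<mu>) t"
proof -
  have "(\<lambda>x. \<nu> + \<mu> * (\<sigma> * sgn (\<Prod>q=1..N. s q - (t - x)))) \<in> borel_measurable borel"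
    by measurable
  then have "switching \<mu> \<nu> t \<sigma> N s \<in> borel_measurable (lebesgue_on {0..t})"
    unfolding switching_def[abs_def] by (simp add: measurable_completion measurable_restrict_space1)
  moreover have "switching \<mu> \<nu> t \<sigma> N s x \<in> {\<nu> - \<mu>..\<nu> + \<mu>}" for x
    using assms by (auto simp: switching_def sgn_if)
  ultimately show ?thesis by (simp add: admissible_def)
qed

lemma has_integral_reverse:
  fixes f :: "real \<Rightarrow> real"
  assumes "(f has_integral I) {0..t}"
  shows "((\<lambda>x. f (t - x)) has_integral I) {0..t}"
proof -
  have "(\<lambda>x. t - x) ` {0..t} = {0..t}"
    by (auto intro: image_eqI[of _ _ "t - _"])
  then show ?thesis
    using has_integral_affinity[of f I 0 t "-1" t] assms by simp
qed

text \<open>This is the source of the closed formula: time reversal turns the kernel into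
  \<open>x ^ m / fact m\<close>, whose integral against the sign pattern is known from
  \<open>has_integral_sgn_prod\<close>.\<close>

lemma response_switching:
  assumes t: "0 \<le> t" and s: "mono_on {1..n - 1} s" "s ` {1..n - 1} \<subseteq> {0..t}"
  shows "response n z t (switching \<mu> \<nu> t \<sigma> (n - 1) s) = (\<lambda>k\<in>{1..n}. bdy_comp n z \<mu> \<nu> t \<sigma> s k)"
  unfolding response_def
proof (rule restrict_ext)
  fix k assume "k \<in> {1..n}"
  define m where "m = n - k"
  define S where "S = (-1) ^ (n - 1) * t ^ Suc m + 2 * (\<Sum>q=1..n - 1. (-1) ^ (q + 1) * s q ^ Suc m)"
  have "((\<lambda>x. x ^ m / fact m) has_integral (t ^ Suc m / fact (Suc m) - 0 ^ Suc m / fact (Suc m))) {0..t}"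
    using t by (rule has_integral_power_fact)
  then have "((\<lambda>x. \<nu> * (x ^ m / fact m)
      + \<mu> * \<sigma> * (x ^ m / fact m * sgn (\<Prod>q=1..n - 1. s q - x))) has_integral
      \<nu> * (t ^ Suc m / fact (Suc m) - 0 ^ Suc m / fact (Suc m)) + \<mu> * \<sigma> * (S / fact (Suc m))) {0..t}"
    unfolding S_def by (intro has_integral_add has_integral_mult_right has_integral_sgn_prod[OF t s])
  note has_integral_reverse[OF this]
  moreover have "\<nu> * ((t - x) ^ m / fact m)
      + \<mu> * \<sigma> * ((t - x) ^ m / fact m * sgn (\<Prod>q=1..n - 1. s q - (t - x)))
      = (t - x) ^ m / fact m * switching \<mu> \<nu> t \<sigma> (n - 1) s x" for x
    by (simp add: switching_def algebra_simps)
  moreover have "\<nu> * (t ^ Suc m / fact (Suc m) - 0 ^ Suc m / fact (Suc m)) + \<mu> * \<sigma> * (S / fact (Suc m))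
      = \<nu> * t ^ Suc m / fact (Suc m) + \<sigma> * (\<mu> / fact (Suc m)) * S"
    by (simp del: fact_Suc)
  ultimately have "((\<lambda>x. (t - x) ^ m / fact m * switching \<mu> \<nu> t \<sigma> (n - 1) s x) has_integral
      \<nu> * t ^ Suc m / fact (Suc m) + \<sigma> * (\<mu> / fact (Suc m)) * S) {0..t}"
    by (simp only:)
  then have "integral {0..t} (\<lambda>x. (t - x) ^ m / fact m * switching \<mu> \<nu> t \<sigma> (n - 1) s x)
      = \<nu> * t ^ Suc m / fact (Suc m) + \<sigma> * (\<mu> / fact (Suc m)) * S"
    by (rule integral_unique)
  then show "(\<Sum>l=1..n. (if k \<le> l then 1 else 0) * (t ^ (l - k) / fact (l - k)) * z l)
     + integral {0..t} (\<lambda>x. (t - x) ^ (n - k) / fact (n - k) * switching \<mu> \<nu> t \<sigma> (n - 1) s x)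
     = bdy_comp n z \<mu> \<nu> t \<sigma> s k"
    unfolding bdy_comp_def S_def m_def by simp
qed

section \<open>Linear functionals of the response and uniqueness of their maximizer\<close>

lemma response_diff:
  assumes "u \<in> admissible a b t" "v \<in> admissible a b t" "k \<in> {1..n}"
  shows "((\<lambda>s. (t - s) ^ (n - k) / fact (n - k) * (u s - v s)) has_integral
           (response n z t u k - response n z t v k)) {0..t}"
proof -
  have "((\<lambda>s. (t - s) ^ (n - k) / fact (n - k) * u s) has_integral
      integral {0..t} (\<lambda>s. (t - s) ^ (n - k) / fact (n - k) * u s)) {0..t}"
   and "((\<lambda>s. (t - s) ^ (n - k) / fact (n - k) * v s) has_integral
      integral {0..t} (\<lambda>s. (t - s) ^ (n - k) / fact (n - k) * v s)) {0..t}"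
    by (intro integrable_integral admissible_integrable[OF assms(1)]
        admissible_integrable[OF assms(2)] continuous_intros; simp)+
  from has_integral_diff[OF this] show ?thesis
    using assms(3) by (simp add: response_def right_diff_distrib)
qed

text \<open>The weights \<open>coeff p (n - k) * fact (n - k)\<close> cancel the factorials of the
  kernels and assemble the monomials into \<open>p\<close>. Taking differences of responses removes
  the free part.\<close>

lemma response_functional:
  assumes "u \<in> admissible a b t" "v \<in> admissible a b t" "degree p < n"
  shows "((\<lambda>s. poly p (t - s) * (u s - v s)) has_integral
     (\<Sum>k=1..n. coeff p (n - k) * fact (n - k) * (response n z t u k - response n z t v k))) {0..t}"
proof -
  have "((\<lambda>s. \<Sum>k=1..n. coeff p (n - k) * fact (n - k) * ((t - s) ^ (n - k) / fact (n - k) * (u s - v s)))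
      has_integral
     (\<Sum>k=1..n. coeff p (n - k) * fact (n - k) * (response n z t u k - response n z t v k))) {0..t}"
    using assms by (intro has_integral_sum has_integral_mult_right response_diff) auto
  moreover have "(\<Sum>k=1..n. coeff p (n - k) * fact (n - k) * ((t - s) ^ (n - k) / fact (n - k) * (u s - v s)))
      = poly p (t - s) * (u s - v s)" for s
  proof -
    have "poly p (t - s) = (\<Sum>i<n. coeff p i * (t - s) ^ i)"
      unfolding poly_altdef using assms(3)
      by (intro sum.mono_neutral_left) (auto simp: coeff_eq_0)
    also have "\<dots> = (\<Sum>k=1..n. coeff p (n - k) * (t - s) ^ (n - k))"
      by (rule sum.reindex_bij_witness[of _ "\<lambda>k. n - k" "\<lambda>i. n - i"]) auto
    finally show ?thesis
      by (simp add: sum_distrib_right mult.assoc)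
  qed
  ultimately show ?thesis by simp
qed

text \<open>For pointwise bounds that can fail at switching instants, where the switching input
  takes the middle value \<open>\<nu>\<close>.\<close>

lemma has_integral_abs_le_off_finite:
  fixes f g :: "real \<Rightarrow> real"
  assumes "(f has_integral i) S" "(g has_integral j) S" "finite F"
    and "\<And>x. x \<in> S - F \<Longrightarrow> \<bar>f x\<bar> \<le> g x"
  shows "\<bar>i\<bar> \<le> j"
proof -
  have "((\<lambda>x. if x \<in> F then 0 else f x) has_integral i) S"
    by (rule has_integral_spike_finite[OF assms(3) _ assms(1)]) auto
  moreover have "((\<lambda>x. if x \<in> F then 0 else g x) has_integral j) S"
    by (rule has_integral_spike_finite[OF assms(3) _ assms(2)]) auto
  ultimately show ?thesis
    using integral_norm_bound_integral[of "\<lambda>x. if x \<in> F then 0 else f x" S "\<lambda>x. if x \<in> F then 0 else g x"]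
      assms(4) by (auto simp: has_integral_iff)
qed

text \<open>If \<open>c\<close> is nonzero, the input sits at the end of its range selected by the
  sign of \<open>c\<close>, so its difference from any admissible value \<open>v\<close> is zero or
  has the sign of \<open>c\<close>.\<close>

lemma switching_maximizes:
  assumes \<mu>: "0 \<le> \<mu>" and \<sigma>: "\<sigma> \<in> {1, -1}"
    and sign: "0 \<le> \<sigma> * (\<Prod>q=1..N. s q - (t - x)) * c"
    and c: "c = 0 \<or> (\<Prod>q=1..N. s q - (t - x)) \<noteq> 0"
    and v: "v \<in> {\<nu> - \<mu>..\<nu> + \<mu>}"
  shows "c * (switching \<mu> \<nu> t \<sigma> N s x - v) = \<bar>c\<bar> * \<bar>switching \<mu> \<nu> t \<sigma> N s x - v\<bar>"
proof (cases "c = 0")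
  case False
  define \<pi> where "\<pi> = (\<Prod>q=1..N. s q - (t - x))"
  define \<epsilon> where "\<epsilon> = \<sigma> * sgn \<pi>"
  have "\<pi> \<noteq> 0" using c False by (simp add: \<pi>_def)
  then have \<epsilon>: "\<epsilon> = 1 \<or> \<epsilon> = -1"
    using \<sigma> by (auto simp: \<epsilon>_def sgn_if)
  have "0 \<le> \<epsilon> * c"
    using sign \<open>\<pi> \<noteq> 0\<close> \<sigma> unfolding \<pi>_def[symmetric] \<epsilon>_def
    by (auto simp: sgn_if zero_le_mult_iff mult_le_0_iff split: if_splits)
  moreover have "switching \<mu> \<nu> t \<sigma> N s x - v = \<nu> + \<mu> * \<epsilon> - v"
    by (simp add: switching_def \<epsilon>_def \<pi>_def)
  ultimately have "0 \<le> c * (switching \<mu> \<nu> t \<sigma> N s x - v)"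
    using \<epsilon> v \<mu> by (auto simp: zero_le_mult_iff)
  then show ?thesis
    by (metis abs_mult abs_of_nonneg)
qed simp

text \<open>Quantitative uniqueness of the maximizer: \<open>1 \<le> C * \<bar>p\<bar> + max 0 (1 - C * \<bar>p\<bar>)\<close> bounds the
  \<open>L\<^sup>1\<close> distance to the switching input by the defect of the functional plus an error
  which vanishes as \<open>C\<close> grows.\<close>

lemma response_estimate:
  assumes t: "0 \<le> t" and \<mu>: "0 \<le> \<mu>" and \<sigma>: "\<sigma> \<in> {1, -1}" and C: "0 \<le> C"
    and p: "degree p < n"
    and sign: "\<And>x. x \<in> {0..t} \<Longrightarrow> 0 \<le> \<sigma> * (\<Prod>q=1..N. s q - x) * poly p x"
    and u: "u \<in> admissible (\<nu> - \<mu>) (\<nu> + \<mu>) t" and k: "k \<in> {1..n}"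
  defines "w \<equiv> switching \<mu> \<nu> t \<sigma> N s"
  shows "\<bar>response n z t u k - response n z t w k\<bar> \<le> t ^ (n - k) / fact (n - k) *
     (C * (\<Sum>k=1..n. coeff p (n - k) * fact (n - k) * (response n z t w k - response n z t u k))
      + 2 * \<mu> * integral {0..t} (\<lambda>x. max 0 (1 - C * \<bar>poly p (t - x)\<bar>)))"
proof -
  have w: "w \<in> admissible (\<nu> - \<mu>) (\<nu> + \<mu>) t"
    unfolding w_def using \<mu> \<sigma> by (rule switching_admissible)
  define F where "F = {x. (\<Prod>q=1..N. s q - (t - x)) = 0}"
  have "F \<subseteq> (\<lambda>q. t - s q) ` {1..N}"
    by (force simp: F_def image_iff)
  then have F: "finite F" by (rule finite_subset) simp
  have int: "((\<lambda>x. max 0 (1 - C * \<bar>poly p (t - x)\<bar>)) has_integral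
      integral {0..t} (\<lambda>x. max 0 (1 - C * \<bar>poly p (t - x)\<bar>))) {0..t}"
    by (intro integrable_integral integrable_continuous_real continuous_intros)
  show ?thesis
  proof (rule has_integral_abs_le_off_finite[OF response_diff[OF u w k] _ F])
    show "((\<lambda>x. t ^ (n - k) / fact (n - k) * (C * (poly p (t - x) * (w x - u x))
          + 2 * \<mu> * max 0 (1 - C * \<bar>poly p (t - x)\<bar>))) has_integral
        t ^ (n - k) / fact (n - k) *
         (C * (\<Sum>k=1..n. coeff p (n - k) * fact (n - k) * (response n z t w k - response n z t u k))
          + 2 * \<mu> * integral {0..t} (\<lambda>x. max 0 (1 - C * \<bar>poly p (t - x)\<bar>)))) {0..t}"
      by (intro has_integral_mult_right has_integral_add response_functional[OF w u p] int)
    fix x assume x: "x \<in> {0..t} - F"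
    have ux: "u x \<in> {\<nu> - \<mu>..\<nu> + \<mu>}" and wx: "w x \<in> {\<nu> - \<mu>..\<nu> + \<mu>}"
      using u w x by (auto simp: admissible_def)
    define c where "c = poly p (t - x)"
    have 1: "\<bar>c\<bar> * \<bar>w x - u x\<bar> = c * (w x - u x)"
      unfolding w_def c_def using x sign[of "t - x"] \<mu> \<sigma> ux
      by (intro switching_maximizes[symmetric]) (auto simp: F_def)
    \<comment> \<open>The bracket is at least 1. Its first summand reproduces the integrand of the
      functional exactly, and the second is paired with the crude bound \<open>2 * \<mu>\<close>,
      the width of the input range.\<close>
    have "\<bar>w x - u x\<bar> \<le> (C * \<bar>c\<bar> + max 0 (1 - C * \<bar>c\<bar>)) * \<bar>w x - u x\<bar>"
      using mult_right_mono[of 1 "C * \<bar>c\<bar> + max 0 (1 - C * \<bar>c\<bar>)" "\<bar>w x - u x\<bar>"] by simp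
    also have "\<dots> = C * (c * (w x - u x)) + max 0 (1 - C * \<bar>c\<bar>) * \<bar>w x - u x\<bar>"
      by (simp add: distrib_right mult.assoc 1)
    also have "max 0 (1 - C * \<bar>c\<bar>) * \<bar>w x - u x\<bar> \<le> max 0 (1 - C * \<bar>c\<bar>) * (2 * \<mu>)"
      using ux wx by (intro mult_left_mono) auto
    finally have *: "\<bar>w x - u x\<bar> \<le> C * (c * (w x - u x)) + 2 * \<mu> * max 0 (1 - C * \<bar>c\<bar>)"
      by (simp add: mult_ac)
    have "\<bar>(t - x) ^ (n - k) / fact (n - k) * (u x - w x)\<bar> =
        (t - x) ^ (n - k) / fact (n - k) * \<bar>w x - u x\<bar>"
      using x by (simp add: abs_mult abs_minus_commute)
    also have "\<dots> \<le> t ^ (n - k) / fact (n - k) *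
        (C * (c * (w x - u x)) + 2 * \<mu> * max 0 (1 - C * \<bar>c\<bar>))"
      using x * by (intro mult_mono divide_right_mono power_mono) auto
    finally show "\<bar>(t - x) ^ (n - k) / fact (n - k) * (u x - w x)\<bar> \<le> t ^ (n - k) / fact (n - k) *
        (C * (poly p (t - x) * (w x - u x)) + 2 * \<mu> * max 0 (1 - C * \<bar>poly p (t - x)\<bar>))"
      by (simp only: c_def)
  qed
qed

text \<open>The integrands lie between 0 and 1 and converge to the indicator of the finite root set,
  so dominated convergence applies.\<close>

lemma small_poly_integral_tendsto_0:
  assumes "p \<noteq> 0"
  shows "(\<lambda>C::nat. integral {0..t} (\<lambda>x. max 0 (1 - real C * \<bar>poly p (t - x)\<bar>))) \<longlonglongrightarrow> 0"
proof -
  define Z where "Z = {x. poly p (t - x) = 0}"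
  have "Z = (\<lambda>y. t - y) ` {y. poly p y = 0}"
    unfolding Z_def by (auto intro!: image_eqI[of _ _ "t - _"])
  then have Z: "finite Z"
    using poly_roots_finite[OF assms] by simp
  have "(\<lambda>C::nat. integral {0..t} (\<lambda>x. max 0 (1 - real C * \<bar>poly p (t - x)\<bar>))) \<longlonglongrightarrow>
      integral {0..t} (\<lambda>x. if x \<in> Z then 1 else 0)"
  proof (rule dominated_convergence(2)[where h = "\<lambda>_. 1"])
    fix x
    show "(\<lambda>C. max 0 (1 - real C * \<bar>poly p (t - x)\<bar>)) \<longlonglongrightarrow> (if x \<in> Z then 1 else 0)"
    proof (cases "x \<in> Z")
      case False
      then have pos: "0 < \<bar>poly p (t - x)\<bar>" by (simp add: Z_def)
      obtain C0 where C0: "1 < real C0 * \<bar>poly p (t - x)\<bar>"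
        using reals_Archimedean3[OF pos] by blast
      have "\<forall>\<^sub>F C in sequentially. max 0 (1 - real C * \<bar>poly p (t - x)\<bar>) = 0"
        unfolding eventually_sequentially
      proof (intro exI[of _ C0] allI impI)
        fix C assume "C0 \<le> C"
        then have "real C0 * \<bar>poly p (t - x)\<bar> \<le> real C * \<bar>poly p (t - x)\<bar>"
          by (intro mult_right_mono) auto
        then show "max 0 (1 - real C * \<bar>poly p (t - x)\<bar>) = 0" using C0 by simp
      qed
      then show ?thesis using False by (simp add: tendsto_eventually)
    qed (simp add: Z_def)
  qed (auto intro!: integrable_continuous_real continuous_intros)
  moreover have "integral {0..t} (\<lambda>x. if x \<in> Z then 1 else 0 :: real) = integral {0..t} (\<lambda>_. 0)"
    using Z by (intro integral_spike[of Z]) auto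
  ultimately show ?thesis by simp
qed

section \<open>The frontier of a single block\<close>

definition block_reach :: "nat \<Rightarrow> (nat \<Rightarrow> real) \<Rightarrow> real \<Rightarrow> real \<Rightarrow> real \<Rightarrow> (nat \<Rightarrow> real) set" where
  "block_reach n z a b t = response n z t ` admissible a b t"

section \<open>Supporting hyperplanes and convexity of the reach set\<close>

text \<open>A convex set with empty interior lies in a hyperplane, whose normal serves; otherwise
  interior and relative interior agree. The first case covers degenerate reach sets, such as those
  with \<open>t = 0\<close> or \<open>\<mu> = 0\<close>.\<close>

lemma supporting_hyperplane_frontier:
  fixes S :: "'a::euclidean_space set"
  assumes "convex S" "x \<in> frontier S"
  obtains a where "a \<noteq> 0" "\<And>y. y \<in> S \<Longrightarrow> a \<bullet> y \<le> a \<bullet> x"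
proof (cases "interior S = {}")
  case True
  then obtain a b where a: "a \<noteq> 0" "S \<subseteq> {x. a \<bullet> x = b}"
    using empty_interior_subset_hyperplane[OF assms(1)] by blast
  have "closure S \<subseteq> {x. a \<bullet> x = b}"
    using a(2) by (intro closure_minimal closed_hyperplane)
  then have "a \<bullet> x = b"
    using assms(2) by (auto simp: frontier_def)
  show thesis
  proof (rule that[OF a(1)])
    fix y assume "y \<in> S"
    then have "a \<bullet> y = b" using a(2) by blast
    then show "a \<bullet> y \<le> a \<bullet> x" using \<open>a \<bullet> x = b\<close> by linarith
  qed
next
  case False
  have x: "x \<in> closure S" "x \<notin> rel_interior S"
    using assms(2) rel_interior_nonempty_interior[OF False] by (auto simp: frontier_def)
  obtain a where a: "a \<noteq> 0" "\<And>y. y \<in> closure S \<Longrightarrow> a \<bullet> x \<le> a \<bullet> y"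
    using supporting_hyperplane_relative_frontier[OF assms(1) x] by metis
  show thesis
  proof (rule that[of "- a"])
    fix y assume "y \<in> S"
    then have "a \<bullet> x \<le> a \<bullet> y" using a(2) closure_subset by blast
    then show "- a \<bullet> y \<le> - a \<bullet> x" by simp
  qed (use a(1) in simp)
qed

lemma maximizer_in_frontier:
  fixes S :: "'a::euclidean_space set"
  assumes "x \<in> S" "a \<noteq> 0" "\<And>y. y \<in> S \<Longrightarrow> a \<bullet> y \<le> a \<bullet> x"
  shows "x \<in> frontier S"
proof -
  have "x \<notin> interior S"
  proof
    assume "x \<in> interior S"
    then obtain e where e: "0 < e" "ball x e \<subseteq> S"
      by (auto simp: mem_interior)
    define d where "d = e / (2 * norm a)"
    have d: "0 < d" "norm (d *\<^sub>R a) < e"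
      using e(1) assms(2) by (auto simp: d_def)
    then have "x + d *\<^sub>R a \<in> S"
      using e(2) by (auto simp: dist_norm)
    from assms(3)[OF this] have "d * (a \<bullet> a) \<le> 0"
      by (simp add: inner_right_distrib)
    moreover have "0 < d * (a \<bullet> a)" using d(1) assms(2) by (intro mult_pos_pos) simp_all
    ultimately show False by linarith
  qed
  then show ?thesis
    using assms(1) closure_subset by (auto simp: frontier_def)
qed

lemma response_convex_combination:
  assumes "u \<in> admissible a b t" "v \<in> admissible a b t" "0 \<le> \<rho>" "0 \<le> \<kappa>" "\<rho> + \<kappa> = 1"
  shows "(\<lambda>s. \<rho> * u s + \<kappa> * v s) \<in> admissible a b t"
    and "k \<in> {1..n} \<Longrightarrow> response n z t (\<lambda>s. \<rho> * u s + \<kappa> * v s) k = \<rho> * response n z t u k + \<kappa> * response n z t v k"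
proof -
  have "\<rho> * u s + \<kappa> * v s \<in> {a..b}" if "s \<in> {0..t}" for s
    using assms that convexD[OF convex_real_interval(5)[of a b], of "u s" "v s" \<rho> \<kappa>]
    by (simp add: admissible_def)
  then show w: "(\<lambda>s. \<rho> * u s + \<kappa> * v s) \<in> admissible a b t"
    using assms(1,2) by (auto simp: admissible_def)
  assume k: "k \<in> {1..n}"
  \<comment> \<open>The weighted deviations of \<open>u\<close> and \<open>v\<close> from their mean
    cancel pointwise, so \<open>response_diff\<close> gives the affine relation with no computation
    of the free part.\<close>
  have "((\<lambda>s. \<rho> * ((t - s) ^ (n - k) / fact (n - k) * (u s - (\<rho> * u s + \<kappa> * v s)))
        + \<kappa> * ((t - s) ^ (n - k) / fact (n - k) * (v s - (\<rho> * u s + \<kappa> * v s)))) has_integral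
      \<rho> * (response n z t u k - response n z t (\<lambda>s. \<rho> * u s + \<kappa> * v s) k)
      + \<kappa> * (response n z t v k - response n z t (\<lambda>s. \<rho> * u s + \<kappa> * v s) k)) {0..t}"
    by (intro has_integral_add has_integral_mult_right
        response_diff[OF assms(1) w k] response_diff[OF assms(2) w k])
  moreover have "\<rho> * (g * (x - (\<rho> * x + \<kappa> * y))) + \<kappa> * (g * (y - (\<rho> * x + \<kappa> * y))) = 0" for g x y
  proof -
    have "\<rho> = 1 - \<kappa>" using assms(5) by simp
    show ?thesis unfolding \<open>\<rho> = 1 - \<kappa>\<close> by (simp add: algebra_simps)
  qed
  ultimately have "((\<lambda>_. 0) has_integral
      \<rho> * (response n z t u k - response n z t (\<lambda>s. \<rho> * u s + \<kappa> * v s) k)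
      + \<kappa> * (response n z t v k - response n z t (\<lambda>s. \<rho> * u s + \<kappa> * v s) k)) {0..t}"
    by (simp only:)
  then have "\<rho> * (response n z t u k - response n z t (\<lambda>s. \<rho> * u s + \<kappa> * v s) k)
      + \<kappa> * (response n z t v k - response n z t (\<lambda>s. \<rho> * u s + \<kappa> * v s) k) = 0"
    by (rule has_integral_unique) (rule has_integral_0)
  then have "\<rho> * response n z t u k + \<kappa> * response n z t v k =
      (\<rho> + \<kappa>) * response n z t (\<lambda>s. \<rho> * u s + \<kappa> * v s) k"
    by (simp add: algebra_simps)
  then show "response n z t (\<lambda>s. \<rho> * u s + \<kappa> * v s) k = \<rho> * response n z t u k + \<kappa> * response n z t v k"
    using assms(5) by simp
qed

text \<open>The reach set of one block is viewed as a cylinder in the full state space,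
  \<open>\<pi>\<close> naming the coordinates of the block and all others being free. Inner products
  and convexity are thus available, although the length of a block is not a type.\<close>

locale block =
  fixes \<pi> :: "nat \<Rightarrow> 'n::finite" and n :: nat and z :: "nat \<Rightarrow> real" and \<mu> \<nu> t :: real
  assumes inj: "inj_on \<pi> {1..n}" and n: "1 \<le> n" and t: "0 \<le> t" and \<mu>: "0 \<le> \<mu>"
begin

definition coords :: "real^'n \<Rightarrow> nat \<Rightarrow> real" where
  "coords x = (\<lambda>k\<in>{1..n}. x $ \<pi> k)"

definition inputs :: "(real \<Rightarrow> real) set" where
  "inputs = admissible (\<nu> - \<mu>) (\<nu> + \<mu>) t"

definition cylinder :: "(real^'n) set" where
  "cylinder = {x. coords x \<in> block_reach n z (\<nu> - \<mu>) (\<nu> + \<mu>) t}"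

lemma coords_eq_iff: "coords x = response n z t u \<longleftrightarrow> (\<forall>k\<in>{1..n}. x $ \<pi> k = response n z t u k)"
  by (auto simp: coords_def fun_eq_iff restrict_def response_def)

lemma cylinder_iff: "x \<in> cylinder \<longleftrightarrow> (\<exists>u\<in>inputs. \<forall>k\<in>{1..n}. x $ \<pi> k = response n z t u k)"
  unfolding cylinder_def block_reach_def image_iff mem_Collect_eq inputs_def coords_eq_iff ..

lemma point_exists:
  obtains x where "coords x = response n z t u"
proof -
  have "(\<chi> i. response n z t u (inv_into {1..n} \<pi> i)) $ \<pi> k = response n z t u k" if "k \<in> {1..n}" for k
    using that inj by simp
  then show thesis
    using that coords_eq_iff by blast
qed

lemma inputs_nonempty: "(\<lambda>_. \<nu>) \<in> inputs"
  using \<mu> by (simp add: inputs_def admissible_def)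

lemma convex_cylinder: "convex cylinder"
  unfolding convex_def
proof (intro ballI allI impI)
  fix x y \<rho> \<kappa> assume "x \<in> cylinder" "y \<in> cylinder" and c: "0 \<le> \<rho>" "0 \<le> \<kappa>" "\<rho> + \<kappa> = (1::real)"
  then obtain u v where u: "u \<in> inputs" "\<forall>k\<in>{1..n}. x $ \<pi> k = response n z t u k"
    and v: "v \<in> inputs" "\<forall>k\<in>{1..n}. y $ \<pi> k = response n z t v k"
    by (auto simp: cylinder_iff)
  then show "\<rho> *\<^sub>R x + \<kappa> *\<^sub>R y \<in> cylinder"
    using response_convex_combination[OF _ _ c] u v unfolding cylinder_iff inputs_def
    by (intro bexI[of _ "\<lambda>s. \<rho> * u s + \<kappa> * v s"]) auto
qed

lemma inner_coords:
  assumes "\<And>i. i \<notin> \<pi> ` {1..n} \<Longrightarrow> a $ i = 0"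
  shows "a \<bullet> y = (\<Sum>k=1..n. a $ \<pi> k * y $ \<pi> k)"
proof -
  have "a \<bullet> y = (\<Sum>i\<in>UNIV. a $ i * y $ i)"
    by (simp add: inner_vec_def)
  also have "\<dots> = (\<Sum>i\<in>\<pi> ` {1..n}. a $ i * y $ i)"
    using assms by (intro sum.mono_neutral_right) auto
  finally show ?thesis
    by (simp only: sum.reindex[OF inj] o_def)
qed

text \<open>The polynomial with roots \<open>s q\<close> defines a linear functional that the
  switching input maximizes; a maximizer of a nonzero functional cannot be interior.\<close>

lemma switching_in_frontier:
  assumes \<sigma>: "\<sigma> \<in> {1, -1}" and s: "coords x = response n z t (switching \<mu> \<nu> t \<sigma> (n - 1) s)"
  shows "x \<in> frontier cylinder"
proof -
  define w where "w = switching \<mu> \<nu> t \<sigma> (n - 1) s"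
  have w: "w \<in> admissible (\<nu> - \<mu>) (\<nu> + \<mu>) t"
    unfolding w_def using \<mu> \<sigma> by (rule switching_admissible)
  have x: "x $ \<pi> k = response n z t w k" if "k \<in> {1..n}" for k
    using s that by (simp add: coords_eq_iff w_def)
  define p where "p = smult \<sigma> (\<Prod>q=1..n - 1. [:s q, -1:])"
  have poly_p: "poly p y = \<sigma> * (\<Prod>q=1..n - 1. s q - y)" for y
    by (simp add: p_def poly_prod)
  have deg: "degree p = n - 1"
    using \<sigma> by (auto simp: p_def degree_prod_sum_eq)
  have "p \<noteq> 0"
    using \<sigma> by (auto simp: p_def prod_zero_iff)
  define a :: "real^'n" where
    "a = (\<chi> i. if i \<in> \<pi> ` {1..n} then (\<lambda>k. coeff p (n - k) * fact (n - k)) (inv_into {1..n} \<pi> i) else 0)"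
  have a: "a $ \<pi> k = coeff p (n - k) * fact (n - k)" if "k \<in> {1..n}" for k
    using that inj by (auto simp: a_def)
  have a_inner: "a \<bullet> y = (\<Sum>k=1..n. coeff p (n - k) * fact (n - k) * y $ \<pi> k)" for y
  proof -
    have "a \<bullet> y = (\<Sum>k=1..n. a $ \<pi> k * y $ \<pi> k)"
      by (rule inner_coords) (simp add: a_def)
    then show ?thesis by (simp add: a)
  qed
  show ?thesis
  proof (rule maximizer_in_frontier)
    show "x \<in> cylinder"
      using x w by (auto simp: cylinder_iff inputs_def)
    \<comment> \<open>The leading coefficient is the weight of component 1 of the block, which makes
      the normal vector nonzero.\<close>
    have "coeff p (n - 1) \<noteq> 0"
      using leading_coeff_neq_0[OF \<open>p \<noteq> 0\<close>] by (simp only: deg not_False_eq_True)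
    then have "a $ \<pi> 1 \<noteq> 0"
      using n a[of 1] by simp
    then show "a \<noteq> 0" by auto
    fix y assume "y \<in> cylinder"
    then obtain u where u: "u \<in> admissible (\<nu> - \<mu>) (\<nu> + \<mu>) t"
        and y: "\<And>k. k \<in> {1..n} \<Longrightarrow> y $ \<pi> k = response n z t u k"
      by (auto simp: cylinder_iff inputs_def)
    have "((\<lambda>x. poly p (t - x) * (w x - u x)) has_integral (a \<bullet> x - a \<bullet> y)) {0..t}"
      using response_functional[OF w u, of p n z] deg n x y
      by (simp add: a_inner right_diff_distrib sum_subtractf)
    then have "0 \<le> a \<bullet> x - a \<bullet> y"
    proof (rule has_integral_nonneg)
      fix r assume "r \<in> {0..t}"
      then have "u r \<in> {\<nu> - \<mu>..\<nu> + \<mu>}" using u by (simp add: admissible_def)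
      \<comment> \<open>Here \<open>p\<close> is \<open>\<sigma>\<close> times the switching product
        itself, so the weight vanishes wherever the product does and no instant has to be
        excluded.\<close>
      then have "poly p (t - r) * (w r - u r) = \<bar>poly p (t - r)\<bar> * \<bar>w r - u r\<bar>"
        unfolding w_def using \<mu> \<sigma>
        by (intro switching_maximizes) (auto simp: poly_p)
      then show "0 \<le> poly p (t - r) * (w r - u r)" by simp
    qed
    then show "a \<bullet> y \<le> a \<bullet> x" by simp
  qed
qed

text \<open>The cylinder is unbounded in both directions along every free coordinate, so a
  functional bounded above on it cannot depend on such a coordinate.\<close>

lemma frontier_normal_support:
  assumes "\<And>y. y \<in> cylinder \<Longrightarrow> a \<bullet> y \<le> a \<bullet> x" "i \<notin> \<pi> ` {1..n}"
  shows "a $ i = 0"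
proof (rule ccontr)
  assume ai: "a $ i \<noteq> 0"
  obtain y where y: "coords y = response n z t (\<lambda>_. \<nu>)"
    by (rule point_exists)
  \<comment> \<open>Shifting by this amount raises the functional from its value at \<open>y\<close>
    to \<open>a \<bullet> x + 1\<close>.\<close>
  define d where "d = (a \<bullet> x - a \<bullet> y + 1) / a $ i"
  have "(y + axis i d) $ \<pi> k = y $ \<pi> k" if "k \<in> {1..n}" for k
    using assms(2) that by (auto simp: axis_def)
  then have "y + axis i d \<in> cylinder"
    using y inputs_nonempty by (auto simp: coords_eq_iff cylinder_iff)
  from assms(1)[OF this] show False
    using ai by (simp add: inner_right_distrib inner_axis d_def)
qed

text \<open>A supporting normal at \<open>x\<close> yields a polynomial, whose sign pattern yields a
  switching input with end point \<open>y0\<close>. As \<open>x\<close> is known to lie only in the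
  closure, the estimate for attained points is passed to the limit and forces the block coordinates
  of \<open>x\<close> and \<open>y0\<close> to agree.\<close>

lemma frontier_imp_switching:
  assumes "x \<in> frontier cylinder"
  obtains \<sigma> s where "\<sigma> \<in> {1, -1}" "mono_on {1..n - 1} s" "s ` {1..n - 1} \<subseteq> {0..t}"
    "coords x = response n z t (switching \<mu> \<nu> t \<sigma> (n - 1) s)"
proof -
  obtain a where a: "a \<noteq> 0" "\<And>y. y \<in> cylinder \<Longrightarrow> a \<bullet> y \<le> a \<bullet> x"
    using supporting_hyperplane_frontier[OF convex_cylinder assms] by blast
  have a0: "a $ i = 0" if "i \<notin> \<pi> ` {1..n}" for i
    using frontier_normal_support a(2) that by blast
  then have a_inner: "a \<bullet> y = (\<Sum>k=1..n. a $ \<pi> k * y $ \<pi> k)" for y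
    by (rule inner_coords)
  \<comment> \<open>Division by \<open>fact i\<close> inverts the weights of
    \<open>response_functional\<close>, so \<open>p\<close> represents the functional given by
    \<open>a\<close>.\<close>
  define p where "p = (\<Sum>i\<le>n - 1. monom (a $ \<pi> (n - i) / fact i) i)"
  have coeff_p: "coeff p (n - k) * fact (n - k) = a $ \<pi> k" if "k \<in> {1..n}" for k
  proof -
    have "n - (n - k) = k" "n - k \<le> n - 1" using that by auto
    then show ?thesis by (simp add: p_def coeff_sum_monom)
  qed
  have "degree p \<le> n - 1"
    unfolding p_def by (intro degree_sum_le) (auto intro: order_trans[OF degree_monom_le])
  obtain k0 where "k0 \<in> {1..n}" "a $ \<pi> k0 \<noteq> 0"
    using a(1) a0 by (metis imageE vec_eq_iff zero_index)
  then have "p \<noteq> 0"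
    using coeff_p by force
  from poly_sign_pattern[OF this \<open>degree p \<le> n - 1\<close> t] obtain \<sigma> s
    where s: "\<sigma> \<in> {1, -1}" "mono_on {1..n - 1} s" "s ` {1..n - 1} \<subseteq> {0..t}"
    and sign: "\<And>x. x \<in> {0..t} \<Longrightarrow> 0 \<le> \<sigma> * (\<Prod>q=1..n - 1. s q - x) * poly p x" by blast
  define w where "w = switching \<mu> \<nu> t \<sigma> (n - 1) s"
  have w: "w \<in> inputs"
    unfolding w_def inputs_def using \<mu> s(1) by (rule switching_admissible)
  obtain y0 where y0: "coords y0 = response n z t w"
    by (rule point_exists)
  then have "y0 \<in> cylinder"
    using w by (auto simp: coords_eq_iff cylinder_iff)
  then have a_y0: "a \<bullet> y0 \<le> a \<bullet> x" by (rule a(2))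
  have "x $ \<pi> k = y0 $ \<pi> k" if k: "k \<in> {1..n}" for k
  proof -
    define K where "K = t ^ (n - k) / fact (n - k)"
    define \<delta> where "\<delta> C = integral {0..t} (\<lambda>x. max 0 (1 - real C * \<bar>poly p (t - x)\<bar>))" for C :: nat
    have K: "0 \<le> K" using t by (simp add: K_def)
    have "\<bar>x $ \<pi> k - y0 $ \<pi> k\<bar> \<le> K * (2 * \<mu> * \<delta> C)" for C :: nat
    proof -
      \<comment> \<open>For fixed \<open>C\<close> the estimate is a closed condition on
        \<open>y\<close>, hence it extends from the cylinder to its closure.\<close>
      define H where "H = {y. \<bar>y $ \<pi> k - y0 $ \<pi> k\<bar> \<le> K * (real C * (a \<bullet> y0 - a \<bullet> y) + 2 * \<mu> * \<delta> C)}"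
      have "cylinder \<subseteq> H"
      proof
        fix y assume "y \<in> cylinder"
        then obtain u where u: "u \<in> admissible (\<nu> - \<mu>) (\<nu> + \<mu>) t"
            and y: "\<forall>k\<in>{1..n}. y $ \<pi> k = response n z t u k"
          by (auto simp: cylinder_iff inputs_def)
        have eqs: "y $ \<pi> k = response n z t u k" "y0 $ \<pi> k = response n z t w k"
          using y y0 k by (auto simp: coords_eq_iff)
        have "degree p < n" using \<open>degree p \<le> n - 1\<close> n by linarith
        have a_diff: "a \<bullet> y0 - a \<bullet> y = (\<Sum>k=1..n. coeff p (n - k) * fact (n - k)
            * (response n z t w k - response n z t u k))"
          using y y0 by (simp add: a_inner coeff_p coords_eq_iff right_diff_distrib sum_subtractf)
        show "y \<in> H"
          unfolding H_def mem_Collect_eq eqs a_diff K_def \<delta>_def w_def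
          by (rule response_estimate[OF t \<mu> s(1) of_nat_0_le_iff \<open>degree p < n\<close> _ u k]) (rule sign)
      qed
      moreover have "closed H"
        unfolding H_def by (intro closed_Collect_le continuous_intros)
      ultimately have "closure cylinder \<subseteq> H"
        by (rule closure_minimal)
      then have "\<bar>x $ \<pi> k - y0 $ \<pi> k\<bar> \<le> K * (real C * (a \<bullet> y0 - a \<bullet> x) + 2 * \<mu> * \<delta> C)"
        using assms by (auto simp: frontier_def H_def)
      \<comment> \<open>The point \<open>x\<close> supports and \<open>y0\<close> belongs to the
        cylinder, so the term multiplied by \<open>C\<close> is nonpositive; the rest tends to 0 as
        \<open>C\<close> grows.\<close>
      also have "\<dots> \<le> K * (2 * \<mu> * \<delta> C)"
        using K a_y0 by (intro mult_left_mono) (auto simp: mult_nonneg_nonpos)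
      finally show ?thesis .
    qed
    moreover have "(\<lambda>C. K * (2 * \<mu> * \<delta> C)) \<longlonglongrightarrow> K * (2 * \<mu> * 0)"
      unfolding \<delta>_def by (intro tendsto_intros small_poly_integral_tendsto_0 \<open>p \<noteq> 0\<close>)
    ultimately have "\<bar>x $ \<pi> k - y0 $ \<pi> k\<bar> \<le> K * (2 * \<mu> * 0)"
      by (intro LIMSEQ_le_const) auto
    then show ?thesis by simp
  qed
  then have "coords x = response n z t w"
    using y0 by (simp add: coords_eq_iff)
  then show thesis
    using that s by (simp add: w_def)
qed

lemma frontier_cylinder: "frontier cylinder = {x. coords x \<in> bdy_param n z \<mu> \<nu> t}"
proof (intro equalityI subsetI)
  fix x assume "x \<in> frontier cylinder"
  then obtain \<sigma> s where s: "\<sigma> \<in> {1, -1}" "mono_on {1..n - 1} s" "s ` {1..n - 1} \<subseteq> {0..t}"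
      "coords x = response n z t (switching \<mu> \<nu> t \<sigma> (n - 1) s)"
    by (rule frontier_imp_switching)
  then show "x \<in> {x. coords x \<in> bdy_param n z \<mu> \<nu> t}"
    unfolding bdy_param_def response_switching[OF t s(2,3)] by blast
next
  fix x assume "x \<in> {x. coords x \<in> bdy_param n z \<mu> \<nu> t}"
  then obtain \<sigma> s where s: "\<sigma> \<in> {1, -1}" "mono_on {1..n - 1} s" "s ` {1..n - 1} \<subseteq> {0..t}"
      "coords x = (\<lambda>k\<in>{1..n}. bdy_comp n z \<mu> \<nu> t \<sigma> s k)"
    unfolding bdy_param_def by blast
  then show "x \<in> frontier cylinder"
    using switching_in_frontier[OF s(1)] response_switching[OF t s(2,3)] by metis
qed

lemma closed_cylinder: "closed cylinder"
proof -
  have "frontier cylinder \<subseteq> cylinder"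
  proof
    fix x assume "x \<in> frontier cylinder"
    then obtain \<sigma> s where "\<sigma> \<in> {1, -1}" "coords x = response n z t (switching \<mu> \<nu> t \<sigma> (n - 1) s)"
      by (rule frontier_imp_switching)
    then show "x \<in> cylinder"
      unfolding cylinder_def block_reach_def using switching_admissible[OF \<mu>] by auto
  qed
  then show ?thesis by (simp add: frontier_subset_eq)
qed

end

section \<open>Assembling the blocks\<close>

lemma has_integral_vec_iff:
  fixes f :: "real \<Rightarrow> real^'n"
  shows "(f has_integral y) S \<longleftrightarrow> (\<forall>i. ((\<lambda>x. f x $ i) has_integral y $ i) S)"
  by (subst has_integral_componentwise_iff) (auto simp: Basis_vec_def inner_axis)

lemma borel_measurable_vec_iff:
  fixes f :: "'a \<Rightarrow> real^'n"
  shows "f \<in> borel_measurable M \<longleftrightarrow> (\<forall>i. (\<lambda>x. f x $ i) \<in> borel_measurable M)"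
  by (subst borel_measurable_euclidean_space) (auto simp: Basis_vec_def inner_axis)

section \<open>Frontiers under continuous sections and finite intersections\<close>

lemma continuous_map_vec:
  fixes f :: "'a \<Rightarrow> real^'n"
  assumes "\<And>i. continuous_map X euclideanreal (\<lambda>x. f x $ i)"
  shows "continuous_map X euclidean f"
  using assms by (auto simp: continuous_map_atin intro: vec_tendstoI)

text \<open>Intended for \<open>f\<close> the projection to one block and \<open>g\<close> its
  extension by zero: closures in the product space of a block can be read off from those of
  cylinders in the Euclidean space.\<close>

lemma closure_of_continuous_section:
  assumes f: "continuous_map Y X f" and g: "continuous_map X Y g"
    and fg: "\<And>y. y \<in> topspace X \<Longrightarrow> f (g y) = y" and "S \<subseteq> topspace X"
    and E: "E = {x \<in> topspace Y. f x \<in> S}"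
  shows "X closure_of S = {y \<in> topspace X. g y \<in> Y closure_of E}"
proof (intro equalityI subsetI)
  fix y assume y: "y \<in> X closure_of S"
  then have "y \<in> topspace X"
    by (rule subsetD[OF closure_of_subset_topspace])
  moreover have "g ` S \<subseteq> E"
    using assms(4) fg continuous_map_image_subset_topspace[OF g] by (auto simp: E)
  then have "g y \<in> Y closure_of E"
    using y continuous_map_image_closure_subset[OF g, of S] closure_of_mono by blast
  ultimately show "y \<in> {y \<in> topspace X. g y \<in> Y closure_of E}" by blast
next
  fix y assume "y \<in> {y \<in> topspace X. g y \<in> Y closure_of E}"
  then have y: "y \<in> topspace X" "g y \<in> Y closure_of E" by auto
  have "f ` E \<subseteq> S" by (auto simp: E)
  then have "f (g y) \<in> X closure_of S"
    using y(2) continuous_map_image_closure_subset[OF f, of E] closure_of_mono by blast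
  then show "y \<in> X closure_of S" using y(1) fg by simp
qed

lemma frontier_of_continuous_section:
  assumes f: "continuous_map Y X f" and g: "continuous_map X Y g"
    and fg: "\<And>y. y \<in> topspace X \<Longrightarrow> f (g y) = y" and S: "S \<subseteq> topspace X"
    and E: "E = {x \<in> topspace Y. f x \<in> S}"
  shows "X frontier_of S = {y \<in> topspace X. g y \<in> Y frontier_of E}"
proof -
  have "topspace Y - E = {x \<in> topspace Y. f x \<in> topspace X - S}"
    using continuous_map_image_subset_topspace[OF f] by (auto simp: E)
  then have "X closure_of (topspace X - S) = {y \<in> topspace X. g y \<in> Y closure_of (topspace Y - E)}"
    by (intro closure_of_continuous_section[OF f g fg]) auto
  then show ?thesis
    using closure_of_continuous_section[OF assms] by (auto simp: frontier_of_closures)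
qed

lemma interior_finite_INT:
  fixes C :: "'i::finite \<Rightarrow> 'a::topological_space set"
  shows "interior (\<Inter>j. C j) = (\<Inter>j. interior (C j))"
proof
  show "(\<Inter>j. interior (C j)) \<subseteq> interior (\<Inter>j. C j)"
  proof (rule interior_maximal)
    show "(\<Inter>j. interior (C j)) \<subseteq> (\<Inter>j. C j)"
      by (intro INT_greatest) (use interior_subset in blast)
    show "open (\<Inter>j. interior (C j))"
      by (rule open_INT) auto
  qed
qed (intro INT_greatest interior_mono, blast)

text \<open>Interior commutes with finite intersection, so a point of the intersection fails to be
  interior iff it fails to be interior to some member.\<close>

lemma frontier_finite_INT_closed:
  fixes C :: "'i::finite \<Rightarrow> 'a::topological_space set"
  assumes "\<And>j. closed (C j)"
  shows "frontier (\<Inter>j. C j) = {x \<in> (\<Inter>j. C j). \<exists>j. x \<in> frontier (C j)}"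
proof -
  have "closed (\<Inter>j. C j)" using assms by blast
  then show ?thesis
    using assms unfolding frontier_def interior_finite_INT by auto
qed

section \<open>The stacked system in block coordinates\<close>

locale labelled_blocks =
  fixes r :: "'m::finite \<Rightarrow> nat" and e :: "'m \<times> nat \<Rightarrow> 'n::finite"
  assumes r_pos: "\<And>j. 1 \<le> r j" and labelling: "bij_betw e (block_index r) UNIV"
begin

lemma inv_label: "k \<in> {1..r j} \<Longrightarrow> inv_into (block_index r) e (e (j, k)) = (j, k)"
  using labelling by (intro inv_into_f_f) (auto simp: bij_betw_def block_index_def)

lemma all_labels: "(\<forall>i. Q i) \<longleftrightarrow> (\<forall>j. \<forall>k\<in>{1..r j}. Q (e (j, k)))"
proof -
  have "\<exists>j. \<exists>k\<in>{1..r j}. i = e (j, k)" for i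
  proof -
    have "i \<in> e ` block_index r"
      using labelling by (auto simp: bij_betw_def)
    then show ?thesis by (auto simp: block_index_def)
  qed
  then show ?thesis by metis
qed

lemma sum_labels: "(\<Sum>i\<in>UNIV. f i) = (\<Sum>j\<in>UNIV. \<Sum>k=1..r j. f (e (j, k)))"
proof -
  have "(\<Sum>i\<in>UNIV. f i) = (\<Sum>p\<in>block_index r. f (e p))"
    using labelling by (rule sum.reindex_bij_betw[symmetric])
  also have "\<dots> = (\<Sum>j\<in>UNIV. \<Sum>k=1..r j. f (e (j, k)))"
    unfolding block_index_def by (subst sum.Sigma) (auto simp: case_prod_beta)
  finally show ?thesis .
qed

definition glue :: "('m \<Rightarrow> nat \<Rightarrow> real) \<Rightarrow> real^'n" where
  "glue y = (\<chi> i. case inv_into (block_index r) e i of (j, k) \<Rightarrow> y j k)"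

lemma glue_nth [simp]: "k \<in> {1..r j} \<Longrightarrow> glue y $ e (j, k) = y j k"
  by (simp add: glue_def inv_label)

lemma integrator_A_nth:
  assumes "k \<in> {1..r j}"
  shows "(integrator_A r e *v x) $ e (j, k) = (if k < r j then x $ e (j, Suc k) else 0)"
proof -
  have "(integrator_A r e *v x) $ e (j, k) =
      (\<Sum>i\<in>UNIV. \<Sum>l=1..r i. (if j = i then if l = Suc k then 1 else 0 else 0) * x $ e (i, l))"
    using assms by (simp add: integrator_A_def blkdiag_def matrix_vector_mult_def sum_labels inv_label)
  also have "\<dots> = (\<Sum>i\<in>UNIV. if j = i then (\<Sum>l=1..r j. if l = Suc k then x $ e (j, l) else 0) else 0)"
  proof (intro sum.cong refl)
    fix i
    show "(\<Sum>l=1..r i. (if j = i then if l = Suc k then 1 else 0 else 0) * x $ e (i, l)) =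
        (if j = i then (\<Sum>l=1..r j. if l = Suc k then x $ e (j, l) else 0) else 0)"
    proof (cases "j = i")
      case True
      show ?thesis unfolding True by (simp only: if_True refl) (rule sum.cong; simp)
    qed simp
  qed
  also have "\<dots> = (if k < r j then x $ e (j, Suc k) else 0)"
    by simp
  finally show ?thesis .
qed

lemma integrator_B_nth:
  assumes "k \<in> {1..r j}"
  shows "(integrator_B r e *v u) $ e (j, k) = (if k = r j then u $ j else 0)"
proof -
  \<comment> \<open>Input blocks have length 1, so \<open>fst\<close> is a labelling of the columns
    and column \<open>i\<close> carries the label \<open>(i, 1)\<close>.\<close>
  have "inj_on fst (block_index (\<lambda>_::'m. 1))"
    by (auto simp: block_index_def inj_on_def)
  then have "inv_into (block_index (\<lambda>_. 1)) fst i = (i, 1)" for i :: 'm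
    using inv_into_f_f[of fst "block_index (\<lambda>_. 1)" "(i, 1)"] by (simp add: block_index_def)
  then have "(integrator_B r e *v u) $ e (j, k) =
      (\<Sum>i\<in>UNIV. (if j = i then if k = r i then 1 else 0 else 0) * u $ i)"
    using assms by (simp add: integrator_B_def blkdiag_def matrix_vector_mult_def inv_label)
  also have "\<dots> = (\<Sum>i\<in>UNIV. if j = i then if k = r j then u $ j else 0 else 0)"
    by (intro sum.cong) auto
  finally show ?thesis by simp
qed

text \<open>The input is appended as level \<open>Suc (r j)\<close>, so that every row of the system
  says that level \<open>k\<close> has derivative level \<open>Suc k\<close>.\<close>

definition chain :: "(real \<Rightarrow> real^'n) \<Rightarrow> (real \<Rightarrow> real^'m) \<Rightarrow> 'm \<Rightarrow> nat \<Rightarrow> real \<Rightarrow> real" where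
  "chain x u j k s = (if k \<le> r j then x s $ e (j, k) else u s $ j)"

lemma integrator_nth:
  assumes "k \<in> {1..r j}"
  shows "(integrator_A r e *v x s + integrator_B r e *v u s) $ e (j, k) = chain x u j (Suc k) s"
  using assms by (simp add: integrator_A_nth integrator_B_nth chain_def del: atLeastAtMost_iff) auto

lemma integrator_solution_iff:
  "((\<lambda>s. integrator_A r e *v x s + integrator_B r e *v u s) has_integral y) S \<longleftrightarrow>
   (\<forall>j. \<forall>k\<in>{1..r j}. (chain x u j (Suc k) has_integral y $ e (j, k)) S)"
  unfolding has_integral_vec_iff all_labels
  by (intro arg_cong[of _ _ All] ext ball_cong refl) (simp only: integrator_nth)

text \<open>The blocks share no states or inputs and the input set is a box, so inputs can be chosen
  separately for each block. One inclusion is Taylor's formula along a trajectory; the other builds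
  the chains of all blocks and glues them.\<close>

lemma reach_set_eq:
  assumes t: "0 \<le> t"
  shows "reach_set (integrator_A r e) (integrator_B r e) {x0} (cbox \<alpha> \<beta>) t =
    {x. \<forall>j. subvec r e j x \<in> block_reach (r j) (subvec r e j x0) (\<alpha> $ j) (\<beta> $ j) t}"
    (is "?R = ?C")
proof (intro equalityI subsetI)
  fix y assume "y \<in> ?R"
  then obtain x u where y: "y = x t" and x0: "x 0 = x0"
    and u: "u \<in> borel_measurable (lebesgue_on {0..t})" "\<forall>s\<in>{0..t}. u s \<in> cbox \<alpha> \<beta>"
    and x: "continuous_on {0..t} x"
    and sol: "\<forall>\<tau>\<in>{0..t}. ((\<lambda>s. integrator_A r e *v x s + integrator_B r e *v u s)
                has_integral (x \<tau> - x 0)) {0..\<tau>}"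
    unfolding reach_set_def by blast
  have "subvec r e j y \<in> block_reach (r j) (subvec r e j x0) (\<alpha> $ j) (\<beta> $ j) t" for j
  proof -
    have input: "chain x u j (Suc (r j)) = (\<lambda>s. u s $ j)"
      by (simp add: chain_def fun_eq_iff)
    have adm: "(\<lambda>s. u s $ j) \<in> admissible (\<alpha> $ j) (\<beta> $ j) t"
      using u by (auto simp: admissible_def borel_measurable_vec_iff mem_box_cart)
    have "y $ e (j, k) = response (r j) (subvec r e j x0) t (\<lambda>s. u s $ j) k" if k: "k \<in> {1..r j}" for k
    proof -
      have "chain x u j k t =
          (\<Sum>l=1..r j. (if k \<le> l then 1 else 0) * (t ^ (l - k) / fact (l - k)) * chain x u j l 0)
           + integral {0..t} (\<lambda>s. (t - s) ^ (r j - k) / fact (r j - k) * chain x u j (Suc (r j)) s)"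
      proof (rule iterated_integral_taylor[OF t])
        fix i \<tau> assume i: "i \<in> {1..r j}" and \<tau>: "\<tau> \<in> {0..t}"
        have "(chain x u j (Suc i) has_integral (x \<tau> - x 0) $ e (j, i)) {0..\<tau>}"
          using sol[rule_format, OF \<tau>] i by (auto simp: integrator_solution_iff)
        then show "(chain x u j (Suc i) has_integral (chain x u j i \<tau> - chain x u j i 0)) {0..\<tau>}"
          using i by (simp add: chain_def)
      next
        fix i assume "i \<in> {1..r j}"
        then show "continuous_on {0..t} (chain x u j i)"
          unfolding chain_def[abs_def] using x by (auto intro!: continuous_intros)
      next
        show "chain x u j (Suc (r j)) \<in> borel_measurable (lebesgue_on {0..t})"
          unfolding input using adm by (rule admissible_measurable)
        show "\<bar>chain x u j (Suc (r j)) s\<bar> \<le> max \<bar>\<alpha> $ j\<bar> \<bar>\<beta> $ j\<bar>" if "s \<in> {0..t}" for s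
          unfolding input using adm that by (rule admissible_bound)
      qed (use k in auto)
      moreover have "chain x u j l 0 = subvec r e j x0 l" if "l \<in> {1..r j}" for l
        using that by (simp add: chain_def subvec_def x0)
      ultimately show ?thesis
        using k unfolding response_def input by (simp add: chain_def y)
    qed
    then have "subvec r e j y = response (r j) (subvec r e j x0) t (\<lambda>s. u s $ j)"
      by (auto simp: subvec_def response_def restrict_def fun_eq_iff)
    then show ?thesis
      unfolding block_reach_def using adm by blast
  qed
  then show "y \<in> ?C" by blast
next
  fix y assume "y \<in> ?C"
  then have "\<forall>j. \<exists>v\<in>admissible (\<alpha> $ j) (\<beta> $ j) t. subvec r e j y = response (r j) (subvec r e j x0) t v"
    unfolding block_reach_def by blast
  then obtain v where v: "\<And>j. v j \<in> admissible (\<alpha> $ j) (\<beta> $ j) t"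
    and y: "\<And>j. subvec r e j y = response (r j) (subvec r e j x0) t (v j)" by metis
  have "\<exists>w. w (Suc (r j)) = v j \<and> (\<forall>i\<in>{1..r j}. w i 0 = subvec r e j x0 i
      \<and> continuous_on {0..t} (w i) \<and>
      (\<forall>\<tau>\<in>{0..t}. (w (Suc i) has_integral (w i \<tau> - w i 0)) {0..\<tau>}))" for j
  proof -
    have "v j integrable_on {0..t}"
      using admissible_integrable[OF v, of "\<lambda>_. 1"] by simp
    from integrator_chain_exists[OF this, of "r j" "subvec r e j x0"] show ?thesis by metis
  qed
  then obtain w where w: "\<And>j. w j (Suc (r j)) = v j"
    and w0: "\<And>j i. i \<in> {1..r j} \<Longrightarrow> w j i 0 = subvec r e j x0 i"
    and w_cont: "\<And>j i. i \<in> {1..r j} \<Longrightarrow> continuous_on {0..t} (w j i)"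
    and w_int: "\<And>j i \<tau>. i \<in> {1..r j} \<Longrightarrow> \<tau> \<in> {0..t} \<Longrightarrow> (w j (Suc i) has_integral (w j i \<tau> - w j i 0)) {0..\<tau>}"
    by metis
  define x where "x s = glue (\<lambda>j k. w j k s)" for s
  define u where "u s = (\<chi> j. v j s)" for s
  have chain: "chain x u j k = w j k" if "k \<in> {1..Suc (r j)}" for j k
    using that by (auto simp: chain_def fun_eq_iff x_def u_def w le_Suc_eq)
  show "y \<in> ?R"
    unfolding reach_set_def mem_Collect_eq
  proof (intro exI[of _ x] exI[of _ u] conjI ballI)
    have "\<forall>i. y $ i = x t $ i"
      unfolding all_labels
    proof (intro allI ballI)
      fix j k assume k: "k \<in> {1..r j}"
      have "w j k t =
          (\<Sum>l=1..r j. (if k \<le> l then 1 else 0) * (t ^ (l - k) / fact (l - k)) * w j l 0)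
           + integral {0..t} (\<lambda>s. (t - s) ^ (r j - k) / fact (r j - k) * w j (Suc (r j)) s)"
      proof (rule iterated_integral_taylor[OF t])
        show "w j (Suc (r j)) \<in> borel_measurable (lebesgue_on {0..t})"
          unfolding w using v by (rule admissible_measurable)
        show "\<bar>w j (Suc (r j)) s\<bar> \<le> max \<bar>\<alpha> $ j\<bar> \<bar>\<beta> $ j\<bar>" if "s \<in> {0..t}" for s
          unfolding w using v that by (rule admissible_bound)
      qed (use k w_int w_cont in auto)
      also have "\<dots> = response (r j) (subvec r e j x0) t (v j) k"
        using k by (simp add: response_def w w0)
      also have "\<dots> = subvec r e j y k"
        by (simp only: y)
      also have "\<dots> = y $ e (j, k)"
        using k by (simp add: subvec_def)
      finally show "y $ e (j, k) = x t $ e (j, k)"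
        using k by (simp add: x_def)
    qed
    then show "y = x t" by (simp add: vec_eq_iff)
    have "\<forall>i. x 0 $ i = x0 $ i"
      unfolding all_labels by (auto simp: x_def w0 subvec_def)
    then show "x 0 \<in> {x0}" by (simp add: vec_eq_iff)
    show "u \<in> borel_measurable (lebesgue_on {0..t})"
      using v by (auto simp: borel_measurable_vec_iff u_def intro: admissible_measurable)
    show "u s \<in> cbox \<alpha> \<beta>" if "s \<in> {0..t}" for s
      using v that by (auto simp: mem_box_cart u_def admissible_def)
    have "\<forall>i. continuous_on {0..t} (\<lambda>s. x s $ i)"
      unfolding all_labels using w_cont by (auto simp: x_def)
    then show "continuous_on {0..t} x"
      using continuous_on_vec_lambda[of "{0..t}" "\<lambda>i s. x s $ i"] by simp
    fix \<tau> assume \<tau>: "\<tau> \<in> {0..t}"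
    show "((\<lambda>s. integrator_A r e *v x s + integrator_B r e *v u s) has_integral (x \<tau> - x 0)) {0..\<tau>}"
      unfolding integrator_solution_iff
    proof (intro allI ballI)
      fix j k assume k: "k \<in> {1..r j}"
      have "chain x u j (Suc k) = w j (Suc k)"
        using k by (intro chain) auto
      moreover have "(x \<tau> - x 0) $ e (j, k) = w j k \<tau> - w j k 0"
        using k by (simp add: x_def)
      ultimately show "(chain x u j (Suc k) has_integral (x \<tau> - x 0) $ e (j, k)) {0..\<tau>}"
        using w_int[OF k \<tau>] by simp
    qed
  qed
qed

section \<open>Transfer of frontiers from cylinders to the block spaces\<close>

lemma continuous_map_subvec: "continuous_map euclidean (powertop_real {1..r j}) (subvec r e j)"
  unfolding continuous_map_componentwise subvec_def
  by (auto intro!: continuous_intros)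

lemma continuous_map_glue:
  "continuous_map (powertop_real {1..r j}) euclidean (\<lambda>y. glue (\<lambda>i k. if i = j then y k else 0))"
proof (rule continuous_map_vec)
  have "\<forall>i. continuous_map (powertop_real {1..r j}) euclideanreal
      (\<lambda>y. glue (\<lambda>i k. if i = j then y k else 0) $ i)"
    unfolding all_labels
  proof (intro allI ballI)
    fix i k assume k: "k \<in> {1..r i}"
    show "continuous_map (powertop_real {1..r j}) euclideanreal
        (\<lambda>y. glue (\<lambda>i k. if i = j then y k else 0) $ e (i, k))"
      using k by (cases "i = j") (auto intro: continuous_map_product_projection)
  qed
  then show "continuous_map (powertop_real {1..r j}) euclideanreal
      (\<lambda>y. glue (\<lambda>i k. if i = j then y k else 0) $ i)" for i by blast
qed

lemma subvec_glue: "y \<in> extensional {1..r j} \<Longrightarrow> z j = y \<Longrightarrow> subvec r e j (glue z) = y"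
  by (auto simp: subvec_def fun_eq_iff extensional_def)

lemma powertop_frontier_of:
  assumes "S \<subseteq> extensional {1..r j}" "P \<subseteq> extensional {1..r j}"
    and "frontier {x. subvec r e j x \<in> S} = {x. subvec r e j x \<in> P}"
  shows "powertop_real {1..r j} frontier_of S = P"
proof -
  have fg: "subvec r e j (glue (\<lambda>i k. if i = j then y k else 0)) = y" if "y \<in> extensional {1..r j}" for y
    using that by (intro subvec_glue) auto
  have "powertop_real {1..r j} frontier_of S =
      {y \<in> topspace (powertop_real {1..r j}).
        glue (\<lambda>i k. if i = j then y k else 0) \<in> euclidean frontier_of {x. subvec r e j x \<in> S}}"
    using assms(1) fg
    by (intro frontier_of_continuous_section[OF continuous_map_subvec continuous_map_glue])
      (auto simp: PiE_def)
  also have "\<dots> = P"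
    using assms(2,3) fg by (auto simp: PiE_def frontier_of_def frontier_def)
  finally show ?thesis .
qed

text \<open>Every \<open>y\<close> in the factor \<open>S j\<close> is hit because the other blocks
  can be filled with arbitrary points of their nonempty factors.\<close>

lemma subvec_image_blocks:
  assumes "\<And>j. S j \<subseteq> extensional {1..r j}" "\<And>j. S j \<noteq> {}"
  shows "subvec r e j ` {x. \<forall>j. subvec r e j x \<in> S j} = S j"
proof (intro equalityI subsetI)
  fix y assume y: "y \<in> S j"
  have "\<forall>i. \<exists>y. y \<in> S i" using assms(2) by blast
  then obtain b where b: "\<And>i. b i \<in> S i" by metis
  have "subvec r e i (glue (b(j := y))) = (b(j := y)) i" for i
    using b y assms(1) by (intro subvec_glue) auto
  then show "y \<in> subvec r e j ` {x. \<forall>j. subvec r e j x \<in> S j}"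
    using b y by (intro image_eqI[of _ _ "glue (b(j := y))"]) auto
qed auto

end

text \<open>A frontier point of a product may have interior points in all blocks but one. Therefore
  equality with the parameterization is asserted for each block projection, while for the stacked
  set it takes the form of an inclusion and of a description by at least one parameterized
  block.\<close>

theorem theorem2:
  fixes r :: "'m::finite \<Rightarrow> nat"
    and e :: "'m \<times> nat \<Rightarrow> 'n::finite"
    and \<alpha> \<beta> :: "real^'m"
    and x0 :: "real^'n"
    and t :: real
    and \<mu> \<nu> :: "'m \<Rightarrow> real"
    and R :: "(real^'n) set"
    and P :: "'m \<Rightarrow> (nat \<Rightarrow> real) set"
  assumes r_pos: "\<And>j. 1 \<le> r j"
    and labelling: "bij_betw e (block_index r) UNIV"
    and bounds: "\<And>j. \<alpha> $ j \<le> \<beta> $ j"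
    and t_nonneg: "0 \<le> t"
    and mu: "\<And>j. \<mu> j = (\<beta> $ j - \<alpha> $ j) / 2"
    and nu: "\<And>j. \<nu> j = (\<beta> $ j + \<alpha> $ j) / 2"
    and R: "R = reach_set (integrator_A r e) (integrator_B r e) {x0} (cbox \<alpha> \<beta>) t"
    and P: "\<And>j. P j = bdy_param (r j) (subvec r e j x0) (\<mu> j) (\<nu> j) t"
  shows "(\<forall>j. powertop_real {1..r j} frontier_of (subvec r e j ` R) = P j) \<and>
         {x. \<forall>j. subvec r e j x \<in> P j} \<subseteq> frontier R \<and>
         frontier R = {x \<in> R. \<exists>j. subvec r e j x \<in> P j}"
proof -
  interpret labelled_blocks r e
    by unfold_locales (rule r_pos labelling)+
  define S where "S j = block_reach (r j) (subvec r e j x0) (\<alpha> $ j) (\<beta> $ j) t" for j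
  have R_eq: "R = {x. \<forall>j. subvec r e j x \<in> S j}"
    unfolding R S_def by (rule reach_set_eq[OF t_nonneg])
  have block: "block (\<lambda>k. e (j, k)) (r j) (\<mu> j) t" for j
  proof
    show "inj_on (\<lambda>k. e (j, k)) {1..r j}"
      by (rule inj_onI) (metis inv_label prod.inject)
  qed (use r_pos t_nonneg bounds[of j] mu[of j] in auto)
  have bounds_eq: "\<alpha> $ j = \<nu> j - \<mu> j" "\<beta> $ j = \<nu> j + \<mu> j" for j
    by (simp_all add: mu nu field_simps)
  have coords: "block.coords (\<lambda>k. e (j, k)) (r j) x = subvec r e j x" for j x
    by (simp add: block.coords_def[OF block] subvec_def)
  have cylinder: "block.cylinder (\<lambda>k. e (j, k)) (r j) (subvec r e j x0) (\<mu> j) (\<nu> j) t =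
      {x. subvec r e j x \<in> S j}" for j
    unfolding block.cylinder_def[OF block] coords S_def bounds_eq ..
  have closed: "closed {x. subvec r e j x \<in> S j}" for j
    unfolding cylinder[symmetric] by (rule block.closed_cylinder[OF block])
  have frontier: "frontier {x. subvec r e j x \<in> S j} = {x. subvec r e j x \<in> P j}" for j
    using block.frontier_cylinder[OF block[of j], where z = "subvec r e j x0" and \<nu> = "\<nu> j"]
    unfolding cylinder coords P .
  have S_ext: "S j \<subseteq> extensional {1..r j}" for j
    by (auto simp: S_def block_reach_def response_def)
  have P_ext: "P j \<subseteq> extensional {1..r j}" for j
    by (auto simp: P bdy_param_def)
  have "(\<lambda>_. \<alpha> $ j) \<in> admissible (\<alpha> $ j) (\<beta> $ j) t" for j
    using bounds by (simp add: admissible_def)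
  then have S_ne: "S j \<noteq> {}" for j
    unfolding S_def block_reach_def by blast
  have "subvec r e j ` R = S j" for j
    unfolding R_eq by (rule subvec_image_blocks[OF S_ext S_ne])
  then have 1: "powertop_real {1..r j} frontier_of (subvec r e j ` R) = P j" for j
    using powertop_frontier_of[OF S_ext P_ext frontier] by simp
  have "R = (\<Inter>j. {x. subvec r e j x \<in> S j})"
    by (auto simp: R_eq)
  then have 2: "frontier R = {x \<in> R. \<exists>j. subvec r e j x \<in> P j}"
    using frontier_finite_INT_closed[of "\<lambda>j. {x. subvec r e j x \<in> S j}", OF closed]
    by (simp add: frontier)
  have "{x. subvec r e j x \<in> P j} \<subseteq> {x. subvec r e j x \<in> S j}" for j
    using frontier_subset_closed[OF closed, of j] by (simp only: frontier)
  then have "{x. \<forall>j. subvec r e j x \<in> P j} \<subseteq> R"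
    by (auto simp: R_eq)
  then show ?thesis using 1 2 by auto
qed

end
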